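(* Let $\alpha$ be any ideal of an arbitrary commutative ring $A$. Then $\omega(\alpha)=\omega^*(\alpha)$. (Thus every $n$-absorbing ideal is strongly $n$-absorbing.)
   Context: Rings are commutative with $1$. An empty product of elements is $1$, and an empty product of ideals is $A$. An ideal $\alpha$ of $A$ is $n$-absorbing if for all $f_1,\dots,f_{n+1}\in A$ with $\prod_i f_i\in\alpha$ there is some $j$ with $\prod_{i\ne j}f_i\in\alpha$. It is strongly $n$-absorbing if for all ideals $\gamma_1,\dots,\gamma_{n+1}$ of $A$ with $\prod_i\gamma_i\subseteq\alpha$ there is some $j$ with $\prod_{i\ne j}\gamma_i\subseteq\alpha$. $\omega(\alpha)$ (resp. $\omega^*(\alpha)$) denotes the smallest integer $n\ge 0$ such that $\alpha$ is $n$-absorbing (resp. strongly $n$-absorbing), and is $\infty$ if no such $n$ exists. *)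

theory Defs
  imports "HOL-Algebra.Ideal_Product" "HOL-Library.Extended_Nat"
begin

definition n_absorbing :: "('a, 'b) ring_scheme \<Rightarrow> nat \<Rightarrow> 'a set \<Rightarrow> bool"
  where "n_absorbing R n \<alpha> \<longleftrightarrow> ideal \<alpha> R \<and>
    (\<forall>f \<in> {1..n+1} \<rightarrow> carrier R.
      (\<Otimes>\<^bsub>R\<^esub>i\<in>{1..n+1}. f i) \<in> \<alpha> \<longrightarrow>
      (\<exists>j\<in>{1..n+1}. (\<Otimes>\<^bsub>R\<^esub>i\<in>{1..n+1} - {j}. f i) \<in> \<alpha>))"

(* ideals_set R is the library's commutative monoid of ideals of R under the ideal
   product, with unit carrier R; hence an empty product of ideals is carrier R. *)
definition strongly_n_absorbing :: "('a, 'b) ring_scheme \<Rightarrow> nat \<Rightarrow> 'a set \<Rightarrow> bool"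
  where "strongly_n_absorbing R n \<alpha> \<longleftrightarrow> ideal \<alpha> R \<and>
    (\<forall>\<gamma> \<in> {1..n+1} \<rightarrow> {I. ideal I R}.
      (\<Otimes>\<^bsub>ideals_set R\<^esub>i\<in>{1..n+1}. \<gamma> i) \<subseteq> \<alpha> \<longrightarrow>
      (\<exists>j\<in>{1..n+1}. (\<Otimes>\<^bsub>ideals_set R\<^esub>i\<in>{1..n+1} - {j}. \<gamma> i) \<subseteq> \<alpha>))"

(* In enat, the infimum of a nonempty set is its least element and that of {} is \<infinity>. *)
definition omega :: "('a, 'b) ring_scheme \<Rightarrow> 'a set \<Rightarrow> enat"
  where "omega R \<alpha> = (INF n\<in>{n. n_absorbing R n \<alpha>}. enat n)"

definition omega_star :: "('a, 'b) ring_scheme \<Rightarrow> 'a set \<Rightarrow> enat"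
  where "omega_star R \<alpha> = (INF n\<in>{n. strongly_n_absorbing R n \<alpha>}. enat n)"

end

theory Submission
  imports Defs "HOL-Algebra.Free_Abelian_Groups" "HOL-Library.Multiset"
begin

text \<open>
  Suppose \<open>\<alpha>\<close> is \<open>n\<close>-absorbing and \<open>\<gamma>\<^sub>1, \<dots>, \<gamma>\<^sub>n\<^sub>+\<^sub>1\<close> are ideals whose product lies in \<open>\<alpha>\<close> while every
  product \<open>N\<^sub>k\<close> of all of them but \<open>\<gamma>\<^sub>k\<close> does not. Only finitely many elements witness this, so the
  ring may be taken to be finitely generated. We look for \<open>n + 1\<close> elements with product in \<open>\<alpha>\<close>
  such that no product of \<open>n\<close> of them is in \<open>\<alpha>\<close>. Picking generic elements of the \<open>\<gamma>\<^sub>k\<close> works when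
  all residue fields in sight are infinite; the obstruction consists of the \<open>k\<close> for which \<open>N\<^sub>k\<close> is
  finite modulo \<open>\<alpha>\<close>. Enlarging \<open>\<gamma>\<^sub>k\<close> to \<open>(\<alpha> : N\<^sub>k)\<close> for these \<open>k\<close> makes \<open>\<gamma>\<^sub>k\<close> cofinite.
  For the remaining indices Neumann's lemma on coverings by cosets of infinite index yields
  generic elements \<open>g\<^sub>t \<in> \<gamma>\<^sub>t\<close>. With \<open>y\<close> their product, \<open>\<beta> = (\<alpha> : y)\<close> is cofinite, so modulo \<open>\<beta>\<close> the
  ring is a finite product of local rings with nilpotent maximal ideals. There the theorem of Choi
  and Walker (\<open>r\<close>-absorbing ideals contain the \<open>r\<close>-th power of their radical) shows that each local
  factor is not \<open>r\<close>-absorbing for the relevant \<open>r\<close>, which supplies the missing elements; these are not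
  taken from the \<open>\<gamma>\<^sub>k\<close> themselves.
\<close>

section \<open>Subgroups of finite index\<close>

definition addgroup :: "'a::ab_group_add set \<Rightarrow> bool"
  where "addgroup S \<longleftrightarrow> 0 \<in> S \<and> (\<forall>x\<in>S. \<forall>y\<in>S. x - y \<in> S)"

text \<open>The covering form: neither \<open>H\<close> nor the representatives need lie in
  \<open>G\<close>, so the notion is monotone in both arguments without adjusting
  representatives.\<close>

definition finite_index :: "'a::ab_group_add set \<Rightarrow> 'a set \<Rightarrow> bool"
  where "finite_index H G \<longleftrightarrow> (\<exists>C. finite C \<and> (\<forall>x\<in>G. \<exists>c\<in>C. x - c \<in> H))"

lemma addgroupD:
  assumes "addgroup S"
  shows addgroup_0: "0 \<in> S"
    and addgroup_diff: "x \<in> S \<Longrightarrow> y \<in> S \<Longrightarrow> x - y \<in> S"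
    and addgroup_add: "x \<in> S \<Longrightarrow> y \<in> S \<Longrightarrow> x + y \<in> S"
proof -
  show 0: "0 \<in> S" and d: "x \<in> S \<Longrightarrow> y \<in> S \<Longrightarrow> x - y \<in> S" for x y
    using assms by (auto simp: addgroup_def)
  have m: "x \<in> S \<Longrightarrow> - x \<in> S" for x
    using d[OF 0, of x] by simp
  show "x \<in> S \<Longrightarrow> y \<in> S \<Longrightarrow> x + y \<in> S"
    using d[of x "- y"] m by simp
qed

lemma finite_index_mono:
  "finite_index H G \<Longrightarrow> H \<subseteq> H' \<Longrightarrow> G' \<subseteq> G \<Longrightarrow> finite_index H' G'"
  unfolding finite_index_def by (meson subset_iff)

lemma finite_index_trans:
  assumes "addgroup H" "finite_index H K" "finite_index K G"
  shows "finite_index H G"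
proof -
  obtain C where C: "finite C" "\<And>x. x \<in> K \<Longrightarrow> \<exists>c\<in>C. x - c \<in> H"
    using assms(2) unfolding finite_index_def by blast
  obtain D where D: "finite D" "\<And>x. x \<in> G \<Longrightarrow> \<exists>d\<in>D. x - d \<in> K"
    using assms(3) unfolding finite_index_def by blast
  have "\<exists>e\<in>(\<lambda>(c, d). c + d) ` (C \<times> D). x - e \<in> H" if x: "x \<in> G" for x
  proof -
    obtain d where d: "d \<in> D" "x - d \<in> K" using D x by blast
    then obtain c where "c \<in> C" "x - d - c \<in> H" using C by blast
    with d show ?thesis
      by (intro bexI[of _ "c + d"]) (auto simp: algebra_simps)
  qed
  then show ?thesis
    unfolding finite_index_def using C(1) D(1)
    by (intro exI[of _ "(\<lambda>(c, d). c + d) ` (C \<times> D)"]) blast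
qed

lemma finite_index_Int:
  assumes "addgroup H" "addgroup K" "finite_index H G" "finite_index K G"
  shows "finite_index (H \<inter> K) G"
proof -
  obtain C where C: "finite C" "\<And>x. x \<in> G \<Longrightarrow> \<exists>c\<in>C. x - c \<in> H"
    using assms(3) unfolding finite_index_def by blast
  obtain D where D: "finite D" "\<And>x. x \<in> G \<Longrightarrow> \<exists>d\<in>D. x - d \<in> K"
    using assms(4) unfolding finite_index_def by blast
  \<comment> \<open>One common element for each pair of cosets that meet; two elements of the same
    pair of cosets differ by an element of \<open>H \<inter> K\<close>.\<close>
  define r where "r = (\<lambda>(c, d). SOME g. g - c \<in> H \<and> g - d \<in> K)"
  have "\<exists>e\<in>r ` (C \<times> D). x - e \<in> H \<inter> K" if x: "x \<in> G" for x
  proof -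
    obtain c d where cd: "c \<in> C" "x - c \<in> H" "d \<in> D" "x - d \<in> K" using C D x by blast
    then have "x - c \<in> H \<and> x - d \<in> K" by blast
    then have "r (c, d) - c \<in> H \<and> r (c, d) - d \<in> K"
      unfolding r_def prod.case by (rule someI)
    then have "x - r (c, d) \<in> H \<inter> K"
      using addgroup_diff[OF assms(1) cd(2), of "r (c, d) - c"]
        addgroup_diff[OF assms(2) cd(4), of "r (c, d) - d"] by auto
    then show ?thesis using cd by blast
  qed
  then show ?thesis
    unfolding finite_index_def using C(1) D(1)
    by (intro exI[of _ "r ` (C \<times> D)"]) blast
qed

lemma finite_index_INT:
  assumes "finite A" "\<And>i. i \<in> A \<Longrightarrow> addgroup (H i)" "\<And>i. i \<in> A \<Longrightarrow> finite_index (H i) G"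
  shows "finite_index {x. \<forall>i\<in>A. x \<in> H i} G"
  using assms
proof (induction A)
  case empty
  then show ?case unfolding finite_index_def by (intro exI[of _ "{0}"]) auto
next
  case (insert a A)
  have "addgroup {x. \<forall>i\<in>A. x \<in> H i}"
    using insert.prems(1) by (auto simp: addgroup_def)
  then have "finite_index (H a \<inter> {x. \<forall>i\<in>A. x \<in> H i}) G"
    using insert by (intro finite_index_Int) auto
  moreover have "H a \<inter> {x. \<forall>i\<in>A. x \<in> H i} = {x. \<forall>i\<in>insert a A. x \<in> H i}" by auto
  ultimately show ?case by simp
qed

theorem neumann_cosets:
  fixes G :: "'b \<Rightarrow> 'a::ab_group_add set"
  assumes "finite A" "addgroup \<Gamma>"
    and "\<And>i. i \<in> A \<Longrightarrow> addgroup (G i) \<and> G i \<subseteq> \<Gamma> \<and> finite (C i)"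
    and "\<And>x. x \<in> \<Gamma> \<Longrightarrow> \<exists>i\<in>A. \<exists>c\<in>C i. x - c \<in> G i"
  shows "\<exists>i\<in>A. finite_index (G i) \<Gamma>"
  using assms(1,3,4)
proof (induction A arbitrary: C)
  case empty
  then show ?case using addgroup_0[OF assms(2)] by blast
next
  case (insert a A)
  note G = insert.prems(1)
  show ?case
  proof (cases "\<forall>x\<in>\<Gamma>. \<exists>c\<in>C a. x - c \<in> G a")
    case True
    then show ?thesis using G[of a] unfolding finite_index_def by blast
  next
    case False
    then obtain d where d: "d \<in> \<Gamma>" "\<And>c. c \<in> C a \<Longrightarrow> d - c \<notin> G a" by blast
    define C' where "C' i = C i \<union> (\<lambda>(c, e). c - d + e) ` (C a \<times> C i)" for i
    have "\<exists>i\<in>A. \<exists>c\<in>C' i. x - c \<in> G i" if x: "x \<in> \<Gamma>" for x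
    proof (cases "\<exists>i\<in>A. \<exists>c\<in>C i. x - c \<in> G i")
      case True
      then show ?thesis unfolding C'_def by blast
    next
      case False
      then obtain c where c: "c \<in> C a" "x - c \<in> G a"
        using insert.prems(2)[OF x] by blast
      have Ga: "addgroup (G a)" "G a \<subseteq> \<Gamma>" using G by auto
      have "d + (x - c) \<in> \<Gamma>"
        using addgroup_add[OF assms(2) d(1)] c Ga by blast
      then obtain i e where ie: "i \<in> insert a A" "e \<in> C i" "d + (x - c) - e \<in> G i"
        using insert.prems(2) by blast
      have "i \<noteq> a"
      proof
        assume "i = a"
        then have "d + (x - c) - e - (x - c) \<in> G a"
          using ie c addgroup_diff[OF Ga(1)] by blast
        then have "d - e \<in> G a" by (simp add: algebra_simps)
        then show False using d ie \<open>i = a\<close> by blast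
      qed
      moreover have "x - (c - d + e) \<in> G i" using ie(3) by (simp add: algebra_simps)
      moreover have "c - d + e \<in> C' i" using ie c unfolding C'_def by force
      ultimately show ?thesis using ie(1) by blast
    qed
    moreover have "addgroup (G i) \<and> G i \<subseteq> \<Gamma> \<and> finite (C' i)" if "i \<in> A" for i
      using G[of i] G[of a] that by (auto simp: C'_def)
    ultimately show ?thesis using insert.IH[of C'] by blast
  qed
qed

text \<open>Otherwise the \<open>G i\<close> would cover \<open>g0 + H\<close>. Finitely many
  translates of \<open>H\<close> cover \<open>\<Gamma>\<close>, so finitely many cosets of the
  \<open>G i\<close> would too, against Neumann's lemma.\<close>

corollary coset_avoids_infinite_index:
  fixes G :: "'b \<Rightarrow> 'a::ab_group_add set"
  assumes "finite A" "addgroup \<Gamma>" "H \<subseteq> \<Gamma>" "finite_index H \<Gamma>" "g0 \<in> \<Gamma>"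
    and G: "\<And>i. i \<in> A \<Longrightarrow> addgroup (G i) \<and> G i \<subseteq> \<Gamma> \<and> \<not> finite_index (G i) \<Gamma>"
  shows "\<exists>h\<in>H. \<forall>i\<in>A. g0 + h \<notin> G i"
proof (rule ccontr)
  assume *: "\<not> ?thesis"
  obtain D where D: "finite D" "\<And>x. x \<in> \<Gamma> \<Longrightarrow> \<exists>d\<in>D. x - d \<in> H"
    using assms(4) unfolding finite_index_def by blast
  have "\<exists>i\<in>A. \<exists>c\<in>(\<lambda>d. d - g0) ` D. x - c \<in> G i" if "x \<in> \<Gamma>" for x
  proof -
    obtain d where d: "d \<in> D" "x - d \<in> H" using D \<open>x \<in> \<Gamma>\<close> by blast
    then obtain i where "i \<in> A" "g0 + (x - d) \<in> G i" using * by blast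
    moreover have "g0 + (x - d) = x - (d - g0)" by simp
    ultimately show ?thesis using d by auto
  qed
  then have "\<exists>i\<in>A. finite_index (G i) \<Gamma>"
    using assms D(1) by (intro neumann_cosets[where C = "\<lambda>_. (\<lambda>d. d - g0) ` D"]) auto
  then show False using G by blast
qed

section \<open>Absorbing ideals and radicals\<close>

text \<open>Ideals as subsets of a type of class \<open>comm_ring_1\<close>. Rings with a carrier
  are reached at the end through a homomorphism from a polynomial ring, which is such a
  type.\<close>

definition rideal :: "'a::comm_ring_1 set \<Rightarrow> bool"
  where "rideal I \<longleftrightarrow> 0 \<in> I \<and> (\<forall>x\<in>I. \<forall>y\<in>I. x + y \<in> I) \<and> (\<forall>r. \<forall>x\<in>I. r * x \<in> I)"

lemma ridealD:
  assumes "rideal I"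
  shows rideal_0: "0 \<in> I"
    and rideal_add: "x \<in> I \<Longrightarrow> y \<in> I \<Longrightarrow> x + y \<in> I"
    and rideal_mult: "x \<in> I \<Longrightarrow> r * x \<in> I"
    and rideal_mult_right: "x \<in> I \<Longrightarrow> x * r \<in> I"
    and rideal_minus: "x \<in> I \<Longrightarrow> - x \<in> I"
    and rideal_diff: "x \<in> I \<Longrightarrow> y \<in> I \<Longrightarrow> x - y \<in> I"
proof -
  show "0 \<in> I" and a: "x \<in> I \<Longrightarrow> y \<in> I \<Longrightarrow> x + y \<in> I" and m: "x \<in> I \<Longrightarrow> r * x \<in> I"
    for x y r using assms by (auto simp: rideal_def)
  show "x \<in> I \<Longrightarrow> x * r \<in> I" using m[of x r] by (simp add: mult.commute)
  show n: "x \<in> I \<Longrightarrow> - x \<in> I" for x using m[of x "-1"] by simp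
  show "x \<in> I \<Longrightarrow> y \<in> I \<Longrightarrow> x - y \<in> I" using a[of x "- y"] n by simp
qed

lemma rideal_diff_iff: "rideal I \<Longrightarrow> x - y \<in> I \<Longrightarrow> x \<in> I \<longleftrightarrow> y \<in> I"
  using rideal_add[of I "x - y" y] rideal_diff[of I x "x - y"] by auto

lemma rideal_addgroup: "rideal I \<Longrightarrow> addgroup I"
  by (simp add: addgroup_def rideal_0 rideal_diff)

lemma rideal_UNIV: "rideal UNIV"
  by (simp add: rideal_def)

lemma rideal_sum: "rideal I \<Longrightarrow> (\<And>i. i \<in> A \<Longrightarrow> f i \<in> I) \<Longrightarrow> sum f A \<in> I"
  by (induction A rule: infinite_finite_induct) (auto simp: rideal_0 rideal_add)

lemma rideal_prod_diff:
  assumes "rideal I" "\<And>i. i \<in> A \<Longrightarrow> f i - g i \<in> I"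
  shows "prod f A - prod g A \<in> I"
  using assms(2)
proof (induction A rule: infinite_finite_induct)
  case (insert a A)
  have "f a * (prod f A - prod g A) + (f a - g a) * prod g A \<in> I"
    using insert by (intro rideal_add[OF assms(1)] rideal_mult[OF assms(1)]
        rideal_mult_right[OF assms(1)]) auto
  then show ?case using insert by (simp add: algebra_simps)
qed (auto simp: rideal_0[OF assms(1)])

text \<open>The factors form a multiset, so that removing one occurrence of a repeated factor
  corresponds to omitting one index of a family.\<close>

definition absorbing :: "nat \<Rightarrow> 'a::comm_ring_1 set \<Rightarrow> bool"
  where "absorbing r \<beta> \<longleftrightarrow> (\<forall>F. size F = Suc r \<longrightarrow> prod_mset F \<in> \<beta> \<longrightarrow>
    (\<exists>f. f \<in># F \<and> prod_mset (F - {#f#}) \<in> \<beta>))"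

text \<open>Two factors are merged into \<open>a * b\<close>. If the merged factor can be omitted,
  then so can \<open>a\<close> alone, because multiplying by \<open>b\<close> stays in the
  ideal.\<close>

lemma absorbing_Suc:
  assumes "rideal \<beta>" "absorbing r \<beta>"
  shows "absorbing (Suc r) \<beta>"
  unfolding absorbing_def
proof (intro allI impI)
  fix F :: "'a multiset"
  assume F: "size F = Suc (Suc r)" "prod_mset F \<in> \<beta>"
  obtain a F1 where F1: "F = add_mset a F1" "size F1 = Suc r"
    using F(1) by (metis size_eq_Suc_imp_eq_union size_add_mset nat.inject union_single_eq_member)
  obtain b F2 where F2: "F1 = add_mset b F2" "size F2 = r"
    using F1(2) by (metis size_eq_Suc_imp_eq_union size_add_mset nat.inject)
  let ?G = "add_mset (a * b) F2"
  have "size ?G = Suc r" "prod_mset ?G \<in> \<beta>"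
    using F F1 F2 by (simp_all add: mult.assoc)
  then obtain f where f: "f \<in># ?G" "prod_mset (?G - {#f#}) \<in> \<beta>"
    using assms(2) unfolding absorbing_def by blast
  show "\<exists>f. f \<in># F \<and> prod_mset (F - {#f#}) \<in> \<beta>"
  proof (cases "f = a * b")
    case True
    then have "b * prod_mset F2 \<in> \<beta>" using f rideal_mult[OF assms(1)] by simp
    then show ?thesis using F1 F2 by (intro exI[of _ a]) auto
  next
    case False
    then have fF2: "f \<in># F2" using f by auto
    then have "?G - {#f#} = add_mset (a * b) (F2 - {#f#})"
      "F - {#f#} = add_mset a (add_mset b (F2 - {#f#}))"
      using F1 F2 by (auto simp: multiset_eq_iff)
    then show ?thesis using f fF2 F1 F2 by (intro exI[of _ f]) (auto simp: mult.assoc)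
  qed
qed

lemma absorbing_le:
  assumes "rideal \<beta>" "absorbing r \<beta>" "r \<le> s"
  shows "absorbing s \<beta>"
  using assms(3) by (induction s rule: dec_induct) (auto simp: assms absorbing_Suc)

text \<open>
  The theorem of Choi and Walker. Among the monomials outside \<open>\<beta>\<close> of degree at least \<open>card J\<close> take
  one, \<open>W\<close>, of maximal weight. Then \<open>x\<^sub>i W \<in> \<beta>\<close> for all \<open>i\<close>, and \<open>x\<^sub>l W / x\<^sub>k \<in> \<beta>\<close> whenever \<open>k < l\<close>.
  By this triangularity a subset sum \<open>u\<close> of the \<open>x\<^sub>l\<close> can be chosen greedily with \<open>u W / x\<^sub>k \<notin> \<beta>\<close> for
  all \<open>k\<close>, although \<open>u W \<in> \<beta>\<close>.
\<close>

theorem absorbing_radical_prod: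
  fixes x :: "nat \<Rightarrow> 'a::comm_ring_1"
  assumes \<beta>: "rideal \<beta>" "absorbing (card J) \<beta>"
    and J: "finite J" "\<And>i. i \<in> J \<Longrightarrow> \<exists>N. x i ^ N \<in> \<beta>"
  shows "prod x J \<in> \<beta>"
proof (rule ccontr)
  assume neg: "prod x J \<notin> \<beta>"
  define p where "p W = (\<Prod>i\<in>#W. x i)" for W
  \<comment> \<open>\<open>Suc i\<close> is positive, so adding an index raises the weight, and it
    increases with \<open>i\<close>, so replacing an index by a larger one raises it too.\<close>
  define wt where "wt W = (\<Sum>i\<in>#W. Suc i)" for W :: "nat multiset"
  define P where "P W \<longleftrightarrow> set_mset W \<subseteq> J \<and> card J \<le> size W \<and> p W \<notin> \<beta>" for W
  obtain N where N: "\<And>i. i \<in> J \<Longrightarrow> x i ^ N i \<in> \<beta>" using J(2) by metis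
  have P0: "P (mset_set J)"
    using J(1) neg by (simp add: P_def p_def prod_unfold_prod_mset)
  have bounded: "wt W < Suc (\<Sum>i\<in>J. N i * Suc i)" if W: "P W" for W
  proof -
    have count: "count W i \<le> N i" if i: "i \<in> J" for i
    proof (rule ccontr)
      assume "\<not> count W i \<le> N i"
      then have "replicate_mset (N i) i \<subseteq># W"
        by (simp flip: count_le_replicate_mset_subset_eq)
      then obtain V where "W = replicate_mset (N i) i + V"
        by (metis subset_mset.add_diff_inverse)
      then have "p W = x i ^ N i * p V"
        by (simp add: p_def)
      then show False using W N[OF i] rideal_mult_right[OF \<beta>(1)] unfolding P_def by simp
    qed
    have "set_mset V \<subseteq> J \<Longrightarrow> wt V = (\<Sum>i\<in>J. count V i * Suc i)" for V
    proof (induction V)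
      case (add a V)
      have "(\<Sum>i\<in>J. count (add_mset a V) i * Suc i)
          = (\<Sum>i\<in>J. count V i * Suc i + (if i = a then Suc i else 0))"
        by (intro sum.cong) auto
      also have "\<dots> = wt V + Suc a"
        using add J(1) by (simp add: sum.distrib sum.delta del: mult_Suc_right)
      finally show ?case by (simp add: wt_def)
    qed (simp add: wt_def)
    then have "wt W = (\<Sum>i\<in>J. count W i * Suc i)" using W by (simp add: P_def)
    also have "\<dots> \<le> (\<Sum>i\<in>J. N i * Suc i)"
      using count by (intro sum_mono mult_right_mono) auto
    finally show ?thesis by simp
  qed
  obtain W where W: "P W" "\<And>V. P V \<Longrightarrow> wt V \<le> wt W"
    using ex_has_greatest_nat[of P, OF P0, of wt] bounded by blast
  have ext: "x i * p W \<in> \<beta>" if "i \<in> J" for i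
    using W(2)[of "add_mset i W"] that W(1) by (auto simp: P_def p_def wt_def)
  have swap: "x l * p (W - {#k#}) \<in> \<beta>" if "k \<in># W" "l \<in> J" "k < l" for k l
  proof (rule ccontr)
    assume "x l * p (W - {#k#}) \<notin> \<beta>"
    moreover obtain V where V: "W = add_mset k V" using \<open>k \<in># W\<close> by (metis insert_DiffM)
    ultimately have "P (add_mset l V)" using that W(1) by (auto simp: P_def p_def)
    from W(2)[OF this] show False using that V by (simp add: wt_def)
  qed
  have greedy: "\<exists>C\<subseteq>J. (\<forall>l\<in>C. l < m) \<and>
      (\<forall>k. k \<in># W \<longrightarrow> k < m \<longrightarrow> (\<Sum>l\<in>C. x l) * p (W - {#k#}) \<notin> \<beta>)" for m
  proof (induction m)
    case 0
    then show ?case by auto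
  next
    case (Suc m)
    then obtain C where C: "C \<subseteq> J" "\<And>l. l \<in> C \<Longrightarrow> l < m"
      "\<And>k. k \<in># W \<Longrightarrow> k < m \<Longrightarrow> (\<Sum>l\<in>C. x l) * p (W - {#k#}) \<notin> \<beta>" by blast
    show ?case
    proof (cases "m \<in># W \<and> (\<Sum>l\<in>C. x l) * p (W - {#m#}) \<in> \<beta>")
      case False
      then show ?thesis using C by (intro exI[of _ C]) (auto simp: less_Suc_eq)
    next
      case True
      have "m \<in> J" using True W(1) by (auto simp: P_def)
      have fin: "finite C" "m \<notin> C" using C J(1) finite_subset by auto
      \<comment> \<open>Adding \<open>x m\<close> repairs the failure at \<open>m\<close>, since
        \<open>x m * p (W - {#m#})\<close> is \<open>p W\<close>; for \<open>k < m\<close> it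
        changes the value only by an element of \<beta>.\<close>
      have "(\<Sum>l\<in>insert m C. x l) * p (W - {#k#}) \<notin> \<beta>" if k: "k \<in># W" "k < Suc m" for k
      proof
        assume sum: "(\<Sum>l\<in>insert m C. x l) * p (W - {#k#}) \<in> \<beta>"
        show False
        proof (cases "k = m")
          case True
          have "p W = x m * p (W - {#m#})"
            using \<open>m \<in># W \<and> _\<close> unfolding p_def
            by (metis image_mset_add_mset insert_DiffM prod_mset.add_mset)
          also have "\<dots> \<in> \<beta>"
            using rideal_diff[OF \<beta>(1) sum[unfolded True] \<open>m \<in># W \<and> _\<close>[THEN conjunct2]] fin
            by (simp add: algebra_simps)
          finally show False using W(1) by (simp add: P_def)
        next
          case False
          then have "k < m" using k by simp
          then have "x m * p (W - {#k#}) \<in> \<beta>" using swap k \<open>m \<in> J\<close> by blast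
          from rideal_diff[OF \<beta>(1) sum this] have "(\<Sum>l\<in>C. x l) * p (W - {#k#}) \<in> \<beta>"
            using fin by (simp add: algebra_simps)
          then show False using C(3) k \<open>k < m\<close> by blast
        qed
      qed
      then show ?thesis using C \<open>m \<in> J\<close>
        by (intro exI[of _ "insert m C"]) (auto simp: less_Suc_eq)
    qed
  qed
  obtain m where m: "\<And>k. k \<in># W \<Longrightarrow> k < m"
    using finite_nat_set_iff_bounded[of "set_mset W"] by auto
  obtain C where C: "C \<subseteq> J" "\<And>k. k \<in># W \<Longrightarrow> (\<Sum>l\<in>C. x l) * p (W - {#k#}) \<notin> \<beta>"
    using greedy[of m] m by blast
  define u where "u = (\<Sum>l\<in>C. x l)"
  let ?F = "add_mset u (image_mset x W)"
  have "u * p W \<in> \<beta>"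
    unfolding u_def sum_distrib_right using C(1) ext by (intro rideal_sum[OF \<beta>(1)]) blast
  then have "prod_mset ?F \<in> \<beta>" by (simp add: p_def)
  \<comment> \<open>The degree bound \<open>card J \<le> size W\<close> in \<open>P\<close> is there
    for this step.\<close>
  moreover have "absorbing (size W) \<beta>" using \<beta> W(1) by (auto simp: P_def intro: absorbing_le)
  ultimately obtain f where f: "f \<in># ?F" "prod_mset (?F - {#f#}) \<in> \<beta>"
    unfolding absorbing_def by (metis size_add_mset size_image_mset)
  have "f \<noteq> u" using f(2) W(1) by (auto simp: P_def p_def)
  then obtain k where k: "k \<in># W" "f = x k" using f(1) by auto
  obtain V where V: "W = add_mset k V" using k(1) by (metis insert_DiffM)
  have "?F - {#f#} = add_mset u (image_mset x V)"
    using k(2) by (simp add: V add_mset_commute[of u])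
  then have "u * p (W - {#k#}) \<in> \<beta>" using f(2) by (simp add: p_def V)
  then show False using C(2)[OF k(1)] by (simp add: u_def)
qed

section \<open>Cofinite ideals in finitely generated rings\<close>

abbreviation cofinite_ideal :: "'a::comm_ring_1 set \<Rightarrow> bool"
  where "cofinite_ideal I \<equiv> rideal I \<and> finite_index I UNIV"

lemma finite_index_vimage:
  assumes "addgroup H" "finite_index H G" "\<And>x. x \<in> K \<Longrightarrow> f x \<in> G"
    and "\<And>x y. f (x - y) = f x - f y"
  shows "finite_index {x. f x \<in> H} K"
proof -
  obtain C where C: "finite C" "\<And>x. x \<in> G \<Longrightarrow> \<exists>c\<in>C. x - c \<in> H"
    using assms(2) unfolding finite_index_def by blast
  define r where "r c = (SOME x. f x - c \<in> H)" for c
  have "\<exists>e\<in>r ` C. f (x - e) \<in> H" if x: "x \<in> K" for x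
  proof -
    obtain c where c: "c \<in> C" "f x - c \<in> H" using C(2) assms(3)[OF x] by blast
    have "f (r c) - c \<in> H" unfolding r_def using c(2) by (rule someI)
    from addgroup_diff[OF assms(1) c(2) this] have "f (x - r c) \<in> H" by (simp add: assms(4))
    then show ?thesis using c(1) by blast
  qed
  then show ?thesis
    unfolding finite_index_def using C(1) by (intro exI[of _ "r ` C"]) auto
qed

definition pointwise_prod :: "'a::comm_ring_1 set \<Rightarrow> 'a set \<Rightarrow> 'a set"
  where "pointwise_prod X Y = {x * y |x y. x \<in> X \<and> y \<in> Y}"

text \<open>Only the products themselves, not the ideal they generate: containment in an ideal and
  \<open>colon\<close> do not see the difference, and members may be singletons, as needed when an
  ideal is replaced by a chosen element.\<close>

definition family_prods :: "('i \<Rightarrow> 'a::comm_ring_1 set) \<Rightarrow> 'i set \<Rightarrow> 'a set"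
  where "family_prods \<gamma> S = {prod f S |f. \<forall>i\<in>S. f i \<in> \<gamma> i}"

lemma family_prodsI: "(\<And>i. i \<in> S \<Longrightarrow> f i \<in> \<gamma> i) \<Longrightarrow> prod f S \<in> family_prods \<gamma> S"
  unfolding family_prods_def by blast

lemma family_prods_mono:
  "(\<And>i. i \<in> S \<Longrightarrow> \<gamma> i \<subseteq> \<delta> i) \<Longrightarrow> family_prods \<gamma> S \<subseteq> family_prods \<delta> S"
  unfolding family_prods_def by blast

lemma family_prods_cong:
  "(\<And>i. i \<in> S \<Longrightarrow> \<gamma> i = \<delta> i) \<Longrightarrow> family_prods \<gamma> S = family_prods \<delta> S"
  by (intro equalityI family_prods_mono) auto

lemma family_prods_Un:
  assumes "finite S" "finite T" "S \<inter> T = {}"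
  shows "family_prods \<gamma> (S \<union> T) = pointwise_prod (family_prods \<gamma> S) (family_prods \<gamma> T)"
proof (intro equalityI subsetI)
  fix x assume "x \<in> family_prods \<gamma> (S \<union> T)"
  then obtain f where f: "x = prod f (S \<union> T)" "\<And>i. i \<in> S \<union> T \<Longrightarrow> f i \<in> \<gamma> i"
    unfolding family_prods_def by blast
  have "x = prod f S * prod f T" using assms f(1) by (simp add: prod.union_disjoint)
  moreover have "prod f S \<in> family_prods \<gamma> S" "prod f T \<in> family_prods \<gamma> T"
    using f(2) by (auto intro!: family_prodsI)
  ultimately show "x \<in> pointwise_prod (family_prods \<gamma> S) (family_prods \<gamma> T)"
    unfolding pointwise_prod_def by blast
next
  fix x assume "x \<in> pointwise_prod (family_prods \<gamma> S) (family_prods \<gamma> T)"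
  then obtain f g where fin_gen: "x = prod f S * prod g T" "\<And>i. i \<in> S \<Longrightarrow> f i \<in> \<gamma> i"
    "\<And>i. i \<in> T \<Longrightarrow> g i \<in> \<gamma> i"
    unfolding pointwise_prod_def family_prods_def by auto
  let ?h = "\<lambda>i. if i \<in> S then f i else g i"
  have "prod ?h (S \<union> T) = prod ?h S * prod ?h T" using assms by (intro prod.union_disjoint)
  also have "prod ?h S = prod f S" by (intro prod.cong) auto
  also have "prod ?h T = prod g T" using assms(3) by (intro prod.cong) auto
  finally have "x = prod ?h (S \<union> T)" using fin_gen(1) by simp
  then show "x \<in> family_prods \<gamma> (S \<union> T)" using fin_gen by (auto intro!: family_prodsI)
qed

lemma family_prods_insert:
  assumes "finite S" "t \<notin> S"
  shows "family_prods \<gamma> (insert t S) = pointwise_prod (\<gamma> t) (family_prods \<gamma> S)"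
proof -
  have "family_prods \<gamma> {t} = \<gamma> t"
    by (auto simp: family_prods_def)
  then show ?thesis using family_prods_Un[of "{t}" S \<gamma>] assms by simp
qed

locale ideal_of_ring =
  fixes \<alpha> :: "'a::comm_ring_1 set"
  assumes rideal_\<alpha>: "rideal \<alpha>"
begin

definition colon :: "'a set \<Rightarrow> 'a set"
  where "colon X = {r. \<forall>x\<in>X. r * x \<in> \<alpha>}"

lemma rideal_colon: "rideal (colon X)"
  using rideal_0[OF rideal_\<alpha>] rideal_add[OF rideal_\<alpha>] rideal_mult[OF rideal_\<alpha>]
  by (auto simp: rideal_def colon_def distrib_right mult.assoc)

lemma colon_pointwise_prod: "colon (pointwise_prod G X) = {r. \<forall>g\<in>G. \<forall>x\<in>X. r * (g * x) \<in> \<alpha>}"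
  unfolding colon_def pointwise_prod_def by blast

lemma \<alpha>_subset_colon: "\<alpha> \<subseteq> colon X"
  using rideal_mult_right[OF rideal_\<alpha>] by (auto simp: colon_def)

lemma colon_mono: "X \<subseteq> Y \<Longrightarrow> colon Y \<subseteq> colon X"
  by (auto simp: colon_def)

lemma not_cofinite_colon_mono:
  "X \<subseteq> Y \<Longrightarrow> \<not> finite_index (colon X) UNIV \<Longrightarrow> \<not> finite_index (colon Y) UNIV"
  using finite_index_mono[of "colon Y" UNIV "colon X" UNIV] colon_mono by blast

lemma finite_index_colon_zero: "X \<subseteq> \<alpha> \<Longrightarrow> finite_index (colon X) UNIV"
  unfolding finite_index_def
  by (intro exI[of _ "{0}"]) (auto simp: colon_def intro: rideal_mult[OF rideal_\<alpha>])

text \<open>Finite generation is meant modulo \<open>\<alpha>\<close>, here and in the locale below.\<close>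

definition fin_gen :: "'a set \<Rightarrow> bool"
  where "fin_gen \<gamma> \<longleftrightarrow> (\<exists>B. finite B \<and> B \<subseteq> \<gamma> \<and> (\<forall>J. rideal J \<longrightarrow> \<alpha> \<subseteq> J \<longrightarrow> B \<subseteq> J \<longrightarrow> \<gamma> \<subseteq> J))"

lemma fin_genE:
  assumes "fin_gen \<gamma>"
  obtains B where "finite B" "B \<subseteq> \<gamma>"
    "\<And>J. rideal J \<Longrightarrow> \<alpha> \<subseteq> J \<Longrightarrow> B \<subseteq> J \<Longrightarrow> \<gamma> \<subseteq> J"
  using assms unfolding fin_gen_def by blast

lemma fin_gen_UNIV: "fin_gen UNIV"
  unfolding fin_gen_def
proof (intro exI[of _ "{1}"] conjI allI impI subsetI)
  fix J :: "'a set" and x assume "rideal J" "{1} \<subseteq> J"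
  then show "x \<in> J" using rideal_mult[of J 1 x] by simp
qed auto

text \<open>Modulo \<open>H\<close> the ideal \<gamma> is a finitely generated module over the
  finite ring of residues modulo \<open>C\<close>. Combinations of the generators with coefficients
  among the representatives \<open>D\<close> therefore exhaust it.\<close>

lemma finite_index_fin_gen:
  assumes C: "cofinite_ideal C" and \<gamma>: "fin_gen \<gamma>" and H: "rideal H" "\<alpha> \<subseteq> H"
    and CH: "\<And>c g. c \<in> C \<Longrightarrow> g \<in> \<gamma> \<Longrightarrow> c * g \<in> H"
  shows "finite_index H \<gamma>"
proof -
  obtain B where B: "finite B" "B \<subseteq> \<gamma>"
    "\<And>J. rideal J \<Longrightarrow> \<alpha> \<subseteq> J \<Longrightarrow> B \<subseteq> J \<Longrightarrow> \<gamma> \<subseteq> J"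
    using fin_genE[OF \<gamma>] by blast
  obtain D where D: "finite D" "\<And>x. \<exists>d\<in>D. x - d \<in> C"
    using C unfolding finite_index_def by blast
  define J where "J = {x. \<exists>f. x - (\<Sum>b\<in>B. f b * b) \<in> H}"
  have "\<gamma> \<subseteq> J"
  proof (rule B(3))
    show "\<alpha> \<subseteq> J" using H(2) by (auto simp: J_def intro!: exI[of _ "\<lambda>_. 0"])
    show "B \<subseteq> J"
    proof
      fix c assume "c \<in> B"
      have "(\<Sum>b\<in>B. (if b = c then 1 else 0) * b) = (\<Sum>b\<in>B. if b = c then b else 0)"
        by (intro sum.cong) auto
      then have "c - (\<Sum>b\<in>B. (if b = c then 1 else 0) * b) = 0"
        using \<open>c \<in> B\<close> B(1) by simp
      then show "c \<in> J" using rideal_0[OF H(1)] unfolding J_def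
        by (intro CollectI exI[of _ "\<lambda>b. if b = c then 1 else 0"]) simp
    qed
    show "rideal J"
      unfolding rideal_def
    proof (intro conjI ballI allI)
      show "0 \<in> J" using rideal_0[OF H(1)] by (auto simp: J_def intro!: exI[of _ "\<lambda>_. 0"])
    next
      fix x y assume "x \<in> J" "y \<in> J"
      then obtain f g where "x - (\<Sum>b\<in>B. f b * b) \<in> H" "y - (\<Sum>b\<in>B. g b * b) \<in> H"
        by (auto simp: J_def)
      from rideal_add[OF H(1) this] show "x + y \<in> J"
        unfolding J_def
        by (intro CollectI exI[of _ "\<lambda>b. f b + g b"]) (simp add: distrib_right sum.distrib algebra_simps)
    next
      fix r x assume "x \<in> J"
      then obtain f where "x - (\<Sum>b\<in>B. f b * b) \<in> H" by (auto simp: J_def)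
      from rideal_mult[OF H(1) this, of r] show "r * x \<in> J"
        unfolding J_def
        by (intro CollectI exI[of _ "\<lambda>b. r * f b"])
          (simp add: right_diff_distrib sum_distrib_left mult.assoc)
    qed
  qed
  define F where "F = (\<lambda>f. \<Sum>b\<in>B. f b * b) ` (B \<rightarrow>\<^sub>E D)"
  have "\<exists>c\<in>F. x - c \<in> H" if x: "x \<in> \<gamma>" for x
  proof -
    obtain f where f: "x - (\<Sum>b\<in>B. f b * b) \<in> H" using x \<open>\<gamma> \<subseteq> J\<close> by (auto simp: J_def)
    have "\<forall>b. \<exists>d. d \<in> D \<and> f b - d \<in> C" using D(2) by blast
    then obtain s where s: "\<And>b. s b \<in> D" "\<And>b. f b - s b \<in> C" by metis
    have "(\<Sum>b\<in>B. (f b - s b) * b) \<in> H"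
      using B(2) s CH by (intro rideal_sum[OF H(1)]) auto
    from rideal_add[OF H(1) f this] have "x - (\<Sum>b\<in>B. s b * b) \<in> H"
      by (simp add: left_diff_distrib sum_subtractf)
    moreover have "(\<Sum>b\<in>B. s b * b) \<in> F"
      unfolding F_def using s(1) by (intro image_eqI[of _ _ "restrict s B"]) auto
    ultimately show ?thesis by blast
  qed
  moreover have "finite F" unfolding F_def using B(1) D(1) by (simp add: finite_PiE)
  ultimately show ?thesis unfolding finite_index_def by (intro exI[of _ F]) simp
qed

end

locale fin_gen_ring = ideal_of_ring +
  assumes ring_fin_gen: "\<exists>Y. finite Y \<and> (\<forall>S. addgroup S \<longrightarrow> \<alpha> \<subseteq> S \<longrightarrow> 1 \<in> S \<longrightarrow>
    (\<forall>y\<in>Y. \<forall>s\<in>S. y * s \<in> S) \<longrightarrow> S = UNIV)"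
begin

text \<open>Schreier's argument: coset representatives and the ring generators determine finitely many relations.\<close>

lemma cofinite_fin_gen:
  assumes I: "cofinite_ideal I" "\<alpha> \<subseteq> I"
  shows "fin_gen I"
proof -
  obtain Y where Y: "finite Y" "\<forall>S. addgroup S \<longrightarrow> \<alpha> \<subseteq> S \<longrightarrow> 1 \<in> S \<longrightarrow>
      (\<forall>y\<in>Y. \<forall>s\<in>S. y * s \<in> S) \<longrightarrow> S = UNIV"
    using ring_fin_gen by (elim exE conjE)
  have rI: "rideal I" using I by blast
  obtain C where C: "finite C" "\<And>x. \<exists>c\<in>C. x - c \<in> I"
    using I unfolding finite_index_def by blast
  obtain r where r: "\<And>x. r x \<in> C" "\<And>x. x - r x \<in> I" using C(2) by metis
  \<comment> \<open>The relations \<open>x - r x\<close> for these \<open>x\<close> express closure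
    of the representatives, modulo the ideal, under subtraction and under multiplication by the ring
    generators.\<close>
  define R where "R = {0, 1} \<union> (\<lambda>(y, c). y * c) ` (Y \<times> C) \<union> (\<lambda>(c, d). c - d) ` (C \<times> C)"
  define B where "B = (\<lambda>x. x - r x) ` R \<union> (C \<inter> I)"
  have "finite B" unfolding B_def R_def using C(1) Y(1) by auto
  moreover have "B \<subseteq> I" unfolding B_def using r by auto
  moreover have "I \<subseteq> J" if J0: "rideal J" "\<alpha> \<subseteq> J" "B \<subseteq> J" for J
  proof -
    \<comment> \<open>Intersecting with \<open>I\<close> makes the representative of an element of
      \<open>I\<close> lie in \<open>I\<close> itself, hence in \<open>C \<inter> I\<close>, which
      is part of \<open>B\<close>.\<close>
    define K where "K = J \<inter> I"
    have J: "rideal K" "\<alpha> \<subseteq> K" "B \<subseteq> K"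
      using J0 I \<open>B \<subseteq> I\<close> by (auto simp: K_def rideal_def)
    have red: "x - r x \<in> K" if "x \<in> R" for x using J(3) that by (auto simp: B_def)
    define S where "S = {x. \<exists>c\<in>C. x - c \<in> K}"
    have SI: "x \<in> S" if "x - z \<in> K" "z \<in> R" for x z
      using rideal_add[OF J(1) that(1) red[OF that(2)]] r(1) by (auto simp: S_def)
    have "S = UNIV"
    proof (rule Y(2)[rule_format])
      show "addgroup S"
        unfolding addgroup_def
      proof (intro conjI ballI)
        show "0 \<in> S" using SI[of 0 0] rideal_0[OF J(1)] by (simp add: R_def)
        fix x y assume "x \<in> S" "y \<in> S"
        then obtain c d where cd: "c \<in> C" "x - c \<in> K" "d \<in> C" "y - d \<in> K" by (auto simp: S_def)
        have "(x - y) - (c - d) \<in> K"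
          using rideal_diff[OF J(1) cd(2,4)] by (simp add: algebra_simps)
        then show "x - y \<in> S" by (rule SI) (use cd in \<open>auto simp: R_def\<close>)
      qed
      show "\<alpha> \<subseteq> S"
      proof
        fix a assume "a \<in> \<alpha>"
        then have "a - 0 \<in> K" using J(2) by auto
        then show "a \<in> S" by (rule SI) (simp add: R_def)
      qed
      show "1 \<in> S" using SI[of 1 1] rideal_0[OF J(1)] by (simp add: R_def)
      fix y s assume y: "y \<in> Y" "s \<in> S"
      then obtain c where c: "c \<in> C" "s - c \<in> K" by (auto simp: S_def)
      have "y * s - y * c \<in> K" using rideal_mult[OF J(1) c(2), of y] by (simp add: algebra_simps)
      then show "y * s \<in> S" by (rule SI) (use c y in \<open>auto simp: R_def\<close>)
    qed
    show "I \<subseteq> J"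
    proof
      fix x assume x: "x \<in> I"
      obtain c where c: "c \<in> C" "x - c \<in> K" using \<open>S = UNIV\<close> by (auto simp: S_def)
      have "x - c \<in> I" using c(2) by (simp add: K_def)
      from rideal_diff[OF rI x this] have "c \<in> I" by simp
      then have "c \<in> K" using c(1) J(3) by (auto simp: B_def)
      from rideal_add[OF J(1) c(2) this] show "x \<in> J" by (simp add: K_def)
    qed
  qed
  ultimately show ?thesis unfolding fin_gen_def by blast
qed

text \<open>Products of cofinite ideals are cofinite: \<open>I\<close> is finitely generated and,
  modulo \<open>Z\<close>, killed by the cofinite \<open>J\<close>, so it is finite modulo
  \<open>Z\<close>; transitivity of finite index does the rest.\<close>

lemma cofinite_mult:
  assumes I: "cofinite_ideal I" "\<alpha> \<subseteq> I" and J: "cofinite_ideal J" and Z: "rideal Z" "\<alpha> \<subseteq> Z"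
    and IJ: "\<And>a b. a \<in> I \<Longrightarrow> b \<in> J \<Longrightarrow> b * a \<in> Z"
  shows "finite_index Z UNIV"
proof (rule finite_index_trans)
  show "addgroup Z" using Z(1) by (rule rideal_addgroup)
  show "finite_index Z I"
    using finite_index_fin_gen[OF J cofinite_fin_gen[OF I] Z] IJ by blast
  show "finite_index I UNIV" using I by blast
qed

lemma cofinite_family_prods:
  assumes "finite K" "\<And>l. l \<in> K \<Longrightarrow> cofinite_ideal (\<gamma> l) \<and> \<alpha> \<subseteq> \<gamma> l"
    and "rideal Z" "\<alpha> \<subseteq> Z" "family_prods \<gamma> K \<subseteq> Z"
  shows "finite_index Z UNIV"
  using assms
proof (induction K arbitrary: Z)
  case empty
  then have "1 \<in> Z" by (simp add: family_prods_def)
  then have "x \<in> Z" for x using rideal_mult[OF empty(2), of 1 x] by simp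
  then show ?case unfolding finite_index_def by (intro exI[of _ "{0}"]) auto
next
  case (insert l K)
  \<comment> \<open>The quotient \<open>(Z : \<gamma> l)\<close>, which contains the products over
    the smaller index set.\<close>
  define Z' where "Z' = {r. \<forall>g\<in>\<gamma> l. r * g \<in> Z}"
  have Z': "rideal Z'"
    using rideal_0[OF insert.prems(2)] rideal_add[OF insert.prems(2)] rideal_mult[OF insert.prems(2)]
    by (auto simp: Z'_def rideal_def distrib_right mult.assoc)
  have "family_prods \<gamma> K \<subseteq> Z'"
    using insert.prems(4) unfolding family_prods_insert[OF insert.hyps(1,2)]
    by (fastforce simp: Z'_def pointwise_prod_def mult.commute)
  moreover have "\<alpha> \<subseteq> Z'"
    using rideal_mult_right[OF rideal_\<alpha>] insert.prems(3) by (auto simp: Z'_def)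
  ultimately have "finite_index Z' UNIV" using insert Z' by blast
  then show ?case
    using insert.prems Z' by (intro cofinite_mult[of "\<gamma> l" Z' Z]) (auto simp: Z'_def)
qed

text \<open>The bad choices of a generic element: with \<open>g\<close> in place of an ideal, the
  annihilator modulo \<alpha> of the products becomes cofinite.\<close>

definition small_multipliers :: "'a set \<Rightarrow> 'a set \<Rightarrow> 'a set"
  where "small_multipliers \<gamma> X = {g \<in> \<gamma>. finite_index (colon (pointwise_prod {g} X)) UNIV}"

lemma small_multipliers_addgroup:
  assumes "rideal \<gamma>"
  shows "addgroup (small_multipliers \<gamma> X)"
  unfolding addgroup_def
proof (intro conjI ballI)
  have "pointwise_prod {0} X \<subseteq> \<alpha>" using rideal_0[OF rideal_\<alpha>] by (auto simp: pointwise_prod_def)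
  then show "0 \<in> small_multipliers \<gamma> X"
    using rideal_0[OF assms] finite_index_colon_zero by (simp add: small_multipliers_def)
next
  fix x y assume xy: "x \<in> small_multipliers \<gamma> X" "y \<in> small_multipliers \<gamma> X"
  let ?c = "\<lambda>g. colon (pointwise_prod {g} X)"
  have "finite_index (?c x \<inter> ?c y) UNIV"
    using xy by (intro finite_index_Int rideal_addgroup rideal_colon) (auto simp: small_multipliers_def)
  moreover have "?c x \<inter> ?c y \<subseteq> ?c (x - y)"
    using rideal_diff[OF rideal_\<alpha>]
    by (auto simp: colon_pointwise_prod left_diff_distrib right_diff_distrib)
  ultimately have "finite_index (?c (x - y)) UNIV" by (rule finite_index_mono) simp
  then show "x - y \<in> small_multipliers \<gamma> X"
    using xy rideal_diff[OF assms] by (simp add: small_multipliers_def)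
qed

lemma small_multipliers_mult:
  assumes "rideal \<gamma>" "g \<in> small_multipliers \<gamma> X"
  shows "r * g \<in> small_multipliers \<gamma> X"
proof -
  have "colon (pointwise_prod {g} X) \<subseteq> colon (pointwise_prod {r * g} X)"
    using rideal_mult[OF rideal_\<alpha>, of _ r]
    by (auto simp: colon_pointwise_prod mult.assoc mult.left_commute[of _ r])
  moreover have "finite_index (colon (pointwise_prod {g} X)) UNIV" using assms(2) by (simp add: small_multipliers_def)
  ultimately have "finite_index (colon (pointwise_prod {r * g} X)) UNIV"
    using finite_index_mono by blast
  then show ?thesis
    using assms rideal_mult by (auto simp: small_multipliers_def)
qed

text \<open>If the bad elements had finite index, the multipliers sending the generators
  \<open>B\<close> of \<gamma> to bad elements would form a cofinite ideal \<open>S\<close>, itself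
  finitely generated by some \<open>P\<close>. The common annihilator \<open>D\<close> belonging to
  the finitely many products from \<open>P\<close> and \<open>B\<close> is cofinite, and
  \<open>D\<close> times \<open>S\<close> lies in the colon ideal, which would be cofinite.\<close>

lemma small_multipliers_infinite_index:
  assumes \<gamma>: "fin_gen \<gamma>" "rideal \<gamma>" and nc: "\<not> finite_index (colon (pointwise_prod \<gamma> X)) UNIV"
  shows "\<not> finite_index (small_multipliers \<gamma> X) \<gamma>"
proof
  assume fi: "finite_index (small_multipliers \<gamma> X) \<gamma>"
  let ?G = "small_multipliers \<gamma> X"
  obtain B where B: "finite B" "B \<subseteq> \<gamma>"
    "\<And>J. rideal J \<Longrightarrow> \<alpha> \<subseteq> J \<Longrightarrow> B \<subseteq> J \<Longrightarrow> \<gamma> \<subseteq> J"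
    using fin_genE[OF \<gamma>(1)] by blast
  define S where "S = {s. \<forall>b\<in>B. s \<in> {s. s * b \<in> ?G}}"
  have G: "addgroup ?G" using \<gamma>(2) by (rule small_multipliers_addgroup)
  have "finite_index S UNIV"
    unfolding S_def
  proof (intro finite_index_INT B(1))
    fix b assume b: "b \<in> B"
    show "addgroup {s. s * b \<in> ?G}"
      using addgroup_0[OF G] addgroup_diff[OF G] by (auto simp: addgroup_def left_diff_distrib)
    show "finite_index {s. s * b \<in> ?G} UNIV"
      using fi b B(2) rideal_mult[OF \<gamma>(2)]
      by (intro finite_index_vimage[OF G, of \<gamma>]) (auto simp: left_diff_distrib)
  qed
  moreover have "rideal S"
    using addgroup_0[OF G] addgroup_add[OF G] small_multipliers_mult[OF \<gamma>(2)]
    by (auto simp: S_def rideal_def distrib_right mult.assoc)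
  ultimately have S: "cofinite_ideal S" by blast
  have \<alpha>S: "\<alpha> \<subseteq> S"
  proof
    fix a assume a: "a \<in> \<alpha>"
    have "a * b \<in> ?G" if "b \<in> B" for b
    proof -
      have "a * b * x \<in> \<alpha>" for x
        using a rideal_mult_right[OF rideal_\<alpha>] by (simp add: mult.assoc)
      then have "pointwise_prod {a * b} X \<subseteq> \<alpha>" by (auto simp: pointwise_prod_def)
      then show ?thesis
        using that B(2) rideal_mult[OF \<gamma>(2)] finite_index_colon_zero by (auto simp: small_multipliers_def)
    qed
    then show "a \<in> S" by (simp add: S_def)
  qed
  obtain P where P: "finite P" "P \<subseteq> S"
    "\<And>J. rideal J \<Longrightarrow> \<alpha> \<subseteq> J \<Longrightarrow> P \<subseteq> J \<Longrightarrow> S \<subseteq> J"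
    using fin_genE[OF cofinite_fin_gen[OF S \<alpha>S]] by blast
  define D where "D = {d. \<forall>i\<in>P \<times> B. d \<in> colon (pointwise_prod {fst i * snd i} X)}"
  have "finite_index D UNIV"
    unfolding D_def using P(1,2) B(1)
    by (intro finite_index_INT rideal_addgroup rideal_colon) (auto simp: S_def small_multipliers_def)
  moreover have "rideal D"
    unfolding D_def using rideal_colon
    by (auto simp: rideal_def)
  ultimately have D: "cofinite_ideal D" by blast
  have "finite_index (colon (pointwise_prod \<gamma> X)) UNIV"
  proof (rule cofinite_mult[OF S \<alpha>S D rideal_colon \<alpha>_subset_colon])
    fix s d assume s: "s \<in> S" and d: "d \<in> D"
    \<comment> \<open>Two extensions from generators: first from \<open>B\<close> to \<gamma> with
      \<open>p\<close> fixed, then from \<open>P\<close> to \<open>S\<close> with \<open>g\<close>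
      fixed.\<close>
    have 1: "\<gamma> \<subseteq> colon ((\<lambda>x. d * p * x) ` X)" if p: "p \<in> P" for p
    proof (rule B(3)[OF rideal_colon \<alpha>_subset_colon])
      have "b * (d * p * x) \<in> \<alpha>" if "b \<in> B" "x \<in> X" for b x
      proof -
        have "d \<in> colon (pointwise_prod {p * b} X)" using d p that(1) unfolding D_def by force
        then have "d * (p * b * x) \<in> \<alpha>" using that(2) by (auto simp: colon_pointwise_prod)
        moreover have "b * (d * p * x) = d * (p * b * x)" by (simp add: algebra_simps)
        ultimately show ?thesis by (simp only:)
      qed
      then show "B \<subseteq> colon ((\<lambda>x. d * p * x) ` X)" by (auto simp: colon_def)
    qed
    have 2: "S \<subseteq> colon ((\<lambda>x. d * g * x) ` X)" if g: "g \<in> \<gamma>" for g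
    proof (rule P(3)[OF rideal_colon \<alpha>_subset_colon])
      have "p * (d * g * x) \<in> \<alpha>" if "p \<in> P" "x \<in> X" for p x
      proof -
        have "g * (d * p * x) \<in> \<alpha>" using 1[OF that(1)] g that(2) by (auto simp: colon_def)
        moreover have "p * (d * g * x) = g * (d * p * x)" by (simp add: algebra_simps)
        ultimately show ?thesis by (simp only:)
      qed
      then show "P \<subseteq> colon ((\<lambda>x. d * g * x) ` X)" by (auto simp: colon_def)
    qed
    have "d * s * (g * x) \<in> \<alpha>" if "g \<in> \<gamma>" "x \<in> X" for g x
    proof -
      have "s * (d * g * x) \<in> \<alpha>" using 2[OF that(1)] s that(2) by (auto simp: colon_def)
      moreover have "d * s * (g * x) = s * (d * g * x)" by (simp add: algebra_simps)
      ultimately show ?thesis by (simp only:)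
    qed
    then show "d * s \<in> colon (pointwise_prod \<gamma> X)" by (simp add: colon_pointwise_prod)
  qed
  then show False using nc by blast
qed

text \<open>The ideals indexed by \<open>S\<close> are replaced by elements one at a time. At
  \<open>t\<close> each \<open>k \<noteq> t\<close> forbids a subgroup of infinite index in
  \<open>\<delta> t\<close>, whereas the coset of \<open>g0 t\<close> prescribed by
  \<open>H t\<close> has finite index, so it contains an allowed element. The product for
  \<open>k = t\<close> does not involve \<open>\<delta> t\<close>.\<close>

lemma generic_elements:
  assumes "finite S" "finite I" "S \<subseteq> I" "finite E"
    and "\<And>t. t \<in> S \<Longrightarrow> rideal (\<delta> t) \<and> fin_gen (\<delta> t) \<and> H t \<subseteq> \<delta> t \<and> finite_index (H t) (\<delta> t) \<and> g0 t \<in> \<delta> t"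
    and "\<And>k. k \<in> E \<Longrightarrow> \<not> finite_index (colon (family_prods \<delta> (I - {k}))) UNIV"
  shows "\<exists>g. (\<forall>t\<in>S. g t - g0 t \<in> H t) \<and> (\<forall>k\<in>E. \<not> finite_index
    (colon (family_prods (\<lambda>i. if i \<in> S then {g i} else \<delta> i) (I - {k}))) UNIV)"
  using assms(1,3,5)
proof (induction S)
  case empty
  then show ?case using assms(6) by simp
next
  case (insert t S)
  have "\<exists>g. (\<forall>t\<in>S. g t - g0 t \<in> H t) \<and> (\<forall>k\<in>E. \<not> finite_index
      (colon (family_prods (\<lambda>i. if i \<in> S then {g i} else \<delta> i) (I - {k}))) UNIV)"
    using insert.prems by (intro insert.IH) auto
  then obtain g where g: "\<And>t. t \<in> S \<Longrightarrow> g t - g0 t \<in> H t"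
    "\<And>k. k \<in> E \<Longrightarrow> \<not> finite_index
      (colon (family_prods (\<lambda>i. if i \<in> S then {g i} else \<delta> i) (I - {k}))) UNIV"
    by blast
  define \<delta>' where "\<delta>' i = (if i \<in> S then {g i} else \<delta> i)" for i
  have t: "rideal (\<delta> t)" "fin_gen (\<delta> t)" "H t \<subseteq> \<delta> t" "finite_index (H t) (\<delta> t)" "g0 t \<in> \<delta> t"
    using insert.prems by auto
  have split: "family_prods \<epsilon> (I - {k}) = pointwise_prod (\<epsilon> t) (family_prods \<epsilon> (I - {k} - {t}))"
    if "k \<noteq> t" for k and \<epsilon> :: "'b \<Rightarrow> 'a set"
  proof -
    have "I - {k} = insert t (I - {k} - {t})" using that insert.prems(1) by auto
    then show ?thesis
      using family_prods_insert[of "I - {k} - {t}" t \<epsilon>] assms(2) by simp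
  qed
  let ?X = "\<lambda>k. family_prods \<delta>' (I - {k} - {t})"
  have "\<exists>h\<in>H t. \<forall>k\<in>E - {t}. g0 t + h \<notin> small_multipliers (\<delta> t) (?X k)"
  proof (rule coset_avoids_infinite_index)
    fix k assume k: "k \<in> E - {t}"
    have "\<not> finite_index (colon (pointwise_prod (\<delta> t) (?X k))) UNIV"
      using g(2)[of k] k split[of k \<delta>'] insert.hyps(2) by (simp add: \<delta>'_def[abs_def])
    then show "addgroup (small_multipliers (\<delta> t) (?X k)) \<and> small_multipliers (\<delta> t) (?X k) \<subseteq> \<delta> t \<and>
        \<not> finite_index (small_multipliers (\<delta> t) (?X k)) (\<delta> t)"
      using small_multipliers_infinite_index small_multipliers_addgroup t by (auto simp: small_multipliers_def)
  qed (use t assms(4) rideal_addgroup in auto)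
  then obtain h where h: "h \<in> H t" "\<And>k. k \<in> E \<Longrightarrow> k \<noteq> t \<Longrightarrow> g0 t + h \<notin> small_multipliers (\<delta> t) (?X k)"
    by blast
  define g' where "g' = g(t := g0 t + h)"
  define \<delta>'' where "\<delta>'' i = (if i \<in> insert t S then {g' i} else \<delta> i)" for i
  have agree: "\<delta>'' i = \<delta>' i" if "i \<noteq> t" for i using that by (auto simp: \<delta>''_def \<delta>'_def g'_def)
  have "\<not> finite_index (colon (family_prods \<delta>'' (I - {k}))) UNIV" if k: "k \<in> E" for k
  proof (cases "k = t")
    case True
    then have "family_prods \<delta>'' (I - {k}) = family_prods \<delta>' (I - {k})"
      by (intro family_prods_cong agree) auto
    then show ?thesis using g(2)[OF k] by (simp add: \<delta>'_def[abs_def])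
  next
    case False
    have "family_prods \<delta>'' (I - {k} - {t}) = ?X k" by (intro family_prods_cong agree) auto
    moreover have "\<delta>'' t = {g0 t + h}" by (simp add: \<delta>''_def g'_def)
    moreover have "g0 t + h \<in> \<delta> t" using t h(1) rideal_add by blast
    ultimately show ?thesis using h(2)[OF k False] split[OF False, of \<delta>''] by (simp add: small_multipliers_def)
  qed
  moreover have "g' i - g0 i \<in> H i" if "i \<in> insert t S" for i
    using that g(1) h(1) by (auto simp: g'_def)
  ultimately show ?case unfolding \<delta>''_def[abs_def] by blast
qed

end

section \<open>Primes with finite residue field\<close>

lemma finite_index_pigeonhole:
  fixes f :: "nat \<Rightarrow> 'a::ab_group_add"
  assumes "addgroup H" "finite_index H UNIV"
  obtains i j where "i < j" "f i - f j \<in> H"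
proof -
  obtain C where C: "finite C" "\<And>x. \<exists>c\<in>C. x - c \<in> H"
    using assms(2) unfolding finite_index_def by blast
  have "\<forall>x. \<exists>c. c \<in> C \<and> x - c \<in> H" using C(2) by blast
  then obtain r where r: "\<And>x. r x \<in> C" "\<And>x. x - r x \<in> H" by metis
  have "finite (range (\<lambda>i. r (f i)))" using C(1) r(1) by (meson finite_subset image_subsetI)
  then have "\<not> inj (\<lambda>i. r (f i))" using finite_imageD infinite_UNIV_nat by blast
  then obtain i j where ij: "i \<noteq> j" "r (f i) = r (f j)" unfolding inj_def by blast
  have "f i - f j \<in> H" "f j - f i \<in> H"
    using addgroup_diff[OF assms(1) r(2)[of "f i"] r(2)[of "f j"]]
      addgroup_diff[OF assms(1) r(2)[of "f j"] r(2)[of "f i"]] ij(2) by simp_all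
  then show thesis using that ij(1) by (cases i j rule: linorder_cases) auto
qed

text \<open>Each \<open>F s\<close> contains \<open>C\<close> and is determined by the
  representatives modulo \<open>C\<close> that it contains; a choice containing the most of them is
  maximal.\<close>

lemma cofinite_maximal_choice:
  assumes C: "finite_index C UNIV" and s0: "P s0"
    and F: "\<And>s. P s \<Longrightarrow> rideal (F s) \<and> C \<subseteq> F s"
  obtains s where "P s" "\<And>s'. P s' \<Longrightarrow> F s \<subseteq> F s' \<Longrightarrow> F s' \<subseteq> F s"
proof -
  obtain R where R: "finite R" "\<And>x. \<exists>c\<in>R. x - c \<in> C"
    using C unfolding finite_index_def by blast
  have "\<forall>s. P s \<longrightarrow> card (R \<inter> F s) < Suc (card R)"
    using R(1) by (auto simp: less_Suc_eq_le intro: card_mono)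
  from ex_has_greatest_nat[of P, OF s0 this] obtain s
    where s: "P s" "\<And>s'. P s' \<Longrightarrow> card (R \<inter> F s') \<le> card (R \<inter> F s)" by blast
  show thesis
  proof (rule that[OF s(1)])
    fix s' assume s': "P s'" "F s \<subseteq> F s'"
    have "R \<inter> F s = R \<inter> F s'"
      using s' s(2)[OF s'(1)] R(1) by (intro card_seteq) auto
    show "F s' \<subseteq> F s"
    proof
      fix x assume x: "x \<in> F s'"
      obtain c where c: "c \<in> R" "x - c \<in> C" using R(2) by blast
      have "c \<in> F s'" using F[OF s'(1)] c(2) x rideal_diff_iff[of "F s'" x c] by blast
      then have "c \<in> F s" using c(1) \<open>R \<inter> F s = R \<inter> F s'\<close> by auto
      then show "x \<in> F s" using F[OF s(1)] c(2) rideal_diff_iff[of "F s" x c] by blast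
    qed
  qed
qed

definition finite_residue_prime :: "'a::comm_ring_1 set \<Rightarrow> bool"
  where "finite_residue_prime M \<longleftrightarrow> cofinite_ideal M \<and> 1 \<notin> M \<and>
    (\<forall>a b. a * b \<in> M \<longrightarrow> a \<in> M \<or> b \<in> M)"

lemma finite_residue_primeD:
  assumes "finite_residue_prime M"
  shows frp_cofinite: "cofinite_ideal M"
    and frp_rideal: "rideal M"
    and frp_one: "1 \<notin> M"
    and frp_prime: "a * b \<in> M \<Longrightarrow> a \<in> M \<or> b \<in> M"
    and frp_power: "a ^ n \<in> M \<Longrightarrow> a \<in> M"
proof -
  show p: "a * b \<in> M \<Longrightarrow> a \<in> M \<or> b \<in> M" for a b
    using assms by (auto simp: finite_residue_prime_def)
  show o: "1 \<notin> M" "cofinite_ideal M" "rideal M" using assms by (auto simp: finite_residue_prime_def)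
  show "a ^ n \<in> M \<Longrightarrow> a \<in> M" by (induction n) (use p o in auto)
qed

text \<open>A finite domain is a field: two powers of \<open>a\<close> agree modulo
  \<open>M\<close>, and cancelling the smaller one leaves an inverse that is again a power of
  \<open>a\<close>.\<close>

lemma frp_inverse:
  assumes M: "finite_residue_prime M" "a \<notin> M"
  obtains b where "1 - b * a \<in> M"
proof -
  obtain i j where ij: "i < j" "a ^ i - a ^ j \<in> M"
    using finite_index_pigeonhole[of M "\<lambda>i. a ^ i"] frp_cofinite[OF M(1)] rideal_addgroup by blast
  obtain d where d: "j = i + Suc d" using ij(1) less_iff_Suc_add by auto
  have "a ^ i - a ^ j = a ^ i * (1 - a ^ d * a)" by (simp add: d power_add algebra_simps)
  then have "1 - a ^ d * a \<in> M" using ij(2) frp_prime[OF M(1)] frp_power[OF M(1)] M(2) by metis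
  then show thesis using that by blast
qed

lemma frp_incomparable:
  assumes "finite_residue_prime M" "finite_residue_prime N" "M \<noteq> N"
  obtains a where "a \<in> N" "a \<notin> M"
proof (cases "N \<subseteq> M")
  case True
  then obtain a where a: "a \<in> M" "a \<notin> N" using assms(3) by blast
  obtain b where b: "1 - b * a \<in> N" using frp_inverse[OF assms(2) a(2)] .
  have "(1 - b * a) + b * a \<in> M"
    using True a b by (intro rideal_add[OF frp_rideal[OF assms(1)]]
        rideal_mult[OF frp_rideal[OF assms(1)]]) auto
  then show thesis using frp_one[OF assms(1)] by simp
qed (use that in blast)

text \<open>Chinese remaindering: a product of elements of the other primes, each outside
  \<open>M\<close>, is invertible modulo \<open>M\<close>.\<close>

lemma frp_separate:
  assumes "finite A" "\<And>N. N \<in> A \<Longrightarrow> finite_residue_prime N" and M: "M \<in> A"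
  obtains e where "1 - e \<in> M" "\<And>N. N \<in> A \<Longrightarrow> N \<noteq> M \<Longrightarrow> e \<in> N"
proof -
  note frpM = assms(2)[OF M]
  have "\<forall>N\<in>A - {M}. \<exists>a. a \<in> N \<and> a \<notin> M"
    using frp_incomparable[OF frpM assms(2)] by (metis DiffE insertCI)
  then obtain a where a: "\<And>N. N \<in> A - {M} \<Longrightarrow> a N \<in> N \<and> a N \<notin> M" by metis
  have "prod a B \<notin> M" if "finite B" "B \<subseteq> A - {M}" for B
    using that
  proof (induction B)
    case (insert N B)
    then show ?case using frp_prime[OF frpM] a by auto
  qed (use frp_one[OF frpM] in simp)
  then have "prod a (A - {M}) \<notin> M" using assms(1) by blast
  then obtain b where b: "1 - b * prod a (A - {M}) \<in> M" using frp_inverse[OF frpM] by blast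
  show thesis
  proof (rule that[OF b])
    fix N assume N: "N \<in> A" "N \<noteq> M"
    have "prod a (A - {M}) = a N * prod a (A - {M} - {N})"
      using N assms(1) by (intro prod.remove) auto
    then show "b * prod a (A - {M}) \<in> N"
      using a[of N] N frp_rideal[OF assms(2)[OF N(1)]] by (auto intro: rideal_mult rideal_mult_right)
  qed
qed

section \<open>Idempotents modulo an ideal\<close>

lemma idempotent_power:
  assumes "rideal \<beta>" "e * e - e \<in> \<beta>"
  shows "e ^ Suc k - e \<in> \<beta>"
proof (induction k)
  case (Suc k)
  have "e * (e ^ Suc k - e) + (e * e - e) \<in> \<beta>"
    by (intro rideal_add[OF assms(1)] rideal_mult[OF assms(1)] Suc assms(2))
  then show ?case by (simp add: algebra_simps)
qed (simp add: rideal_0[OF assms(1)])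

lemma ex_idempotent_power:
  assumes "cofinite_ideal \<beta>"
  obtains n where "x ^ Suc n * x ^ Suc n - x ^ Suc n \<in> \<beta>"
proof -
  have \<beta>: "rideal \<beta>" using assms by blast
  obtain i j where ij: "i < j" "x ^ i - x ^ j \<in> \<beta>"
    using finite_index_pigeonhole[of \<beta> "\<lambda>i. x ^ i"] assms rideal_addgroup by blast
  obtain d where d: "j = i + Suc d" using ij(1) less_iff_Suc_add by auto
  have step: "x ^ (k + i) - x ^ (k + i + Suc d * t) \<in> \<beta>" for k t
  proof (induction t)
    case (Suc t)
    have "x ^ (k + Suc d * t) * (x ^ i - x ^ j) \<in> \<beta>" by (intro rideal_mult[OF \<beta>] ij(2))
    from rideal_add[OF \<beta> Suc this] show ?case
      by (simp add: d right_diff_distrib power_add algebra_simps)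
  qed (simp add: rideal_0[OF \<beta>])
  \<comment> \<open>The exponent \<open>Suc (m + i)\<close> is a multiple of the period
    \<open>Suc d\<close> and at least \<open>i\<close>, so doubling it does not change the power
    modulo \<beta>.\<close>
  define m where "m = d * Suc i"
  have k: "Suc d * Suc i = Suc m + i" by (simp add: m_def)
  have "x ^ (Suc m + i) - x ^ (Suc m + i + Suc d * Suc i) \<in> \<beta>" by (rule step)
  then have "- (x ^ Suc (m + i) - x ^ (Suc (m + i) + Suc (m + i))) \<in> \<beta>"
    unfolding k by (intro rideal_minus[OF \<beta>]) simp
  then show thesis using that[of "m + i"] by (simp only: power_add minus_diff_eq)
qed

text \<open>
  A primitive idempotent of the finite ring modulo \<open>\<beta>\<close>, found as one outside \<open>M\<close> with maximal
  annihilator: for \<open>m \<in> M\<close> an idempotent power \<open>f\<close> of \<open>e m\<close> would otherwise allow passing to \<open>e (1 - f)\<close>.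
\<close>

lemma local_idempotent:
  assumes \<beta>: "cofinite_ideal \<beta>" and M: "finite_residue_prime M" "\<beta> \<subseteq> M"
  obtains e where "e \<notin> M" "e * e - e \<in> \<beta>" "\<And>m. m \<in> M \<Longrightarrow> \<exists>N. e * m ^ N \<in> \<beta>"
proof -
  have r\<beta>: "rideal \<beta>" using \<beta> by blast
  have rM: "rideal M" using M(1) by (rule frp_rideal)
  define P where "P e \<longleftrightarrow> e \<notin> M \<and> e * e - e \<in> \<beta>" for e
  define F where "F e = {r. r * e \<in> \<beta>}" for e
  have P1: "P 1" using rideal_0[OF r\<beta>] frp_one[OF M(1)] by (simp add: P_def)
  have F: "rideal (F e) \<and> \<beta> \<subseteq> F e" for e
    using rideal_0[OF r\<beta>] rideal_add[OF r\<beta>] rideal_mult[OF r\<beta>] rideal_mult_right[OF r\<beta>]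
    by (auto simp: F_def rideal_def distrib_right mult.assoc)
  obtain e where e: "P e" "\<And>e'. P e' \<Longrightarrow> F e \<subseteq> F e' \<Longrightarrow> F e' \<subseteq> F e"
    by (rule cofinite_maximal_choice[of \<beta> P 1 F]) (use \<beta> P1 F in blast)+
  have ee: "e \<notin> M" "e * e - e \<in> \<beta>" using e(1) by (auto simp: P_def)
  show thesis
  proof (rule that[OF ee])
    fix m assume m: "m \<in> M"
    obtain n where n: "(e * m) ^ Suc n * (e * m) ^ Suc n - (e * m) ^ Suc n \<in> \<beta>"
      using ex_idempotent_power[OF \<beta>] by blast
    define f where "f = (e * m) ^ Suc n"
    have f: "f * f - f \<in> \<beta>" using n by (simp only: f_def)
    have fM: "f \<in> M"
      unfolding f_def power_Suc using m by (intro rideal_mult_right[OF rM] rideal_mult[OF rM])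
    have "P (e * (1 - f))"
      unfolding P_def
    proof
      show "e * (1 - f) \<notin> M"
      proof
        assume "e * (1 - f) \<in> M"
        from rideal_add[OF rM this rideal_mult[OF rM fM, of e]] show False
          using ee(1) by (simp add: algebra_simps)
      qed
      have "(e * e - e) * ((1 - f) * (1 - f)) + e * (f * f - f) \<in> \<beta>"
        by (intro rideal_add[OF r\<beta>] rideal_mult[OF r\<beta>] rideal_mult_right[OF r\<beta>] ee f)
      then show "e * (1 - f) * (e * (1 - f)) - e * (1 - f) \<in> \<beta>" by (simp add: algebra_simps)
    qed
    moreover have "F e \<subseteq> F (e * (1 - f))"
      using rideal_mult_right[OF r\<beta>] by (auto simp: F_def simp flip: mult.assoc)
    moreover have "f \<in> F (e * (1 - f))"
      using rideal_mult[OF r\<beta> rideal_minus[OF r\<beta> f], of e] by (simp add: F_def algebra_simps)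
    \<comment> \<open>Maximality of the annihilator of \<open>e\<close>: whatever kills
      \<open>e * (1 - f)\<close> modulo \<beta> already kills \<open>e\<close>.\<close>
    ultimately have "f * e \<in> \<beta>" using e(2) by (auto simp: F_def)
    then have "e ^ Suc (Suc n) * m ^ Suc n \<in> \<beta>" by (simp add: f_def power_mult_distrib algebra_simps)
    moreover have "(e ^ Suc (Suc n) - e) * m ^ Suc n \<in> \<beta>"
      by (intro rideal_mult_right[OF r\<beta>] idempotent_power[OF r\<beta> ee(2)])
    ultimately have "e ^ Suc (Suc n) * m ^ Suc n - (e ^ Suc (Suc n) - e) * m ^ Suc n \<in> \<beta>"
      by (rule rideal_diff[OF r\<beta>])
    then show "\<exists>N. e * m ^ N \<in> \<beta>" by (intro exI[of _ "Suc n"]) (simp add: left_diff_distrib)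
  qed
qed

text \<open>The product \<open>e * f\<close> is idempotent modulo \<beta>. If it lies in
  \<open>M\<close>, one of its powers lies in \<beta>, hence so does it. Otherwise an element of
  \<open>N\<close> outside \<open>M\<close>, some power of which is killed by \<open>f\<close>,
  contradicts primality of \<open>M\<close>.\<close>

lemma local_idempotents_orthogonal:
  assumes r\<beta>: "rideal \<beta>" and M: "finite_residue_prime M" "\<beta> \<subseteq> M"
    and N: "finite_residue_prime N" "M \<noteq> N"
    and e: "e * e - e \<in> \<beta>" "\<And>m. m \<in> M \<Longrightarrow> \<exists>k. e * m ^ k \<in> \<beta>"
    and f: "f * f - f \<in> \<beta>" "\<And>m. m \<in> N \<Longrightarrow> \<exists>k. f * m ^ k \<in> \<beta>"
  shows "e * f \<in> \<beta>"
proof (cases "e * f \<in> M")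
  case True
  then obtain k where k: "e * (e * f) ^ k \<in> \<beta>" using e(2) by blast
  have "(e * f) * (e * f) - e * f = f * f * (e * e - e) + e * (f * f - f)"
    by (simp add: algebra_simps)
  also have "\<dots> \<in> \<beta>" by (intro rideal_add[OF r\<beta>] rideal_mult[OF r\<beta>] e f)
  finally have "(e * f) ^ Suc k - e * f \<in> \<beta>" by (rule idempotent_power[OF r\<beta>])
  moreover have "(e * f) ^ Suc k \<in> \<beta>"
    using rideal_mult[OF r\<beta> k, of f] by (simp add: ac_simps)
  ultimately show ?thesis using rideal_diff_iff[OF r\<beta>] by blast
next
  case False
  obtain a where a: "a \<in> N" "a \<notin> M" using frp_incomparable[OF M(1) N] .
  obtain k where "f * a ^ k \<in> \<beta>" using f(2)[OF a(1)] by blast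
  from rideal_mult[OF r\<beta> this, of e] have "(e * f) * a ^ k \<in> M" using M(2) by (auto simp: mult.assoc)
  then show ?thesis using frp_prime[OF M(1)] frp_power[OF M(1)] False a(2) by blast
qed

section \<open>Multisets of factors as indexed families\<close>

lemma ex_family_of_mset:
  "finite J \<Longrightarrow> size F = card J \<Longrightarrow> \<exists>x. image_mset x (mset_set J) = F"
proof (induction J arbitrary: F rule: finite_induct)
  case (insert j J)
  then obtain a G where G: "F = add_mset a G" "size G = card J"
    by (metis card_insert_disjoint size_eq_Suc_imp_eq_union size_add_mset nat.inject)
  then obtain x where "image_mset x (mset_set J) = G" using insert.IH by blast
  moreover have "image_mset (x(j := a)) (mset_set J) = image_mset x (mset_set J)"
    using insert.hyps by (intro image_mset_cong) auto
  ultimately have "image_mset (x(j := a)) (mset_set (insert j J)) = F" using insert.hyps G by simp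
  then show ?case by blast
qed auto

lemma prod_mset_family_remove:
  assumes "finite J" "j \<in> J"
  shows "prod_mset (image_mset x (mset_set J) - {#x j#}) = prod x (J - {j})"
proof -
  have "mset_set J = add_mset j (mset_set (J - {j}))"
    using assms by (simp add: mset_set.remove)
  then show ?thesis using assms(1) by (simp add: prod_unfold_prod_mset)
qed

lemma absorbing_family:
  assumes "absorbing r \<beta>" "finite J" "card J = Suc r" "prod x J \<in> \<beta>"
  shows "\<exists>j\<in>J. prod x (J - {j}) \<in> \<beta>"
proof -
  have "size (image_mset x (mset_set J)) = Suc r" using assms(3) by simp
  moreover have "prod_mset (image_mset x (mset_set J)) \<in> \<beta>"
    using assms(4) by (simp add: prod_unfold_prod_mset)
  ultimately obtain f where f: "f \<in># image_mset x (mset_set J)"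
    "prod_mset (image_mset x (mset_set J) - {#f#}) \<in> \<beta>"
    using assms(1) unfolding absorbing_def by blast
  then obtain j where j: "j \<in> J" "f = x j" using assms(2) by auto
  then show ?thesis using f(2) prod_mset_family_remove[OF assms(2) j(1), of x] by auto
qed

lemma not_absorbing_family:
  assumes "\<not> absorbing r \<beta>" "finite J" "card J = Suc r"
  obtains x where "prod x J \<in> \<beta>" "\<And>j. j \<in> J \<Longrightarrow> prod x (J - {j}) \<notin> \<beta>"
proof -
  obtain F where F: "size F = Suc r" "prod_mset F \<in> \<beta>"
    "\<And>f. f \<in># F \<Longrightarrow> prod_mset (F - {#f#}) \<notin> \<beta>"
    using assms(1) unfolding absorbing_def by blast
  obtain x where x: "image_mset x (mset_set J) = F"
    using ex_family_of_mset[OF assms(2)] F(1) assms(3) by metis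
  show thesis
  proof (rule that)
    show "prod x J \<in> \<beta>" using F(2) x by (simp add: prod_unfold_prod_mset)
    fix j assume j: "j \<in> J"
    then have "x j \<in># F" using x assms(2) by auto
    from F(3)[OF this] show "prod x (J - {j}) \<notin> \<beta>"
      using prod_mset_family_remove[OF assms(2) j, of x] x by simp
  qed
qed


text \<open>The contrapositive of the radical theorem: the elements \<open>f i\<close> only certify
  that \<beta> fails to be absorbing in degree \<open>card J - 1\<close>, and the failing factors
  \<open>x\<close> may be quite different.\<close>

lemma radical_block:
  fixes J :: "nat set"
  assumes \<beta>: "rideal \<beta>" and J: "finite J" "k \<in> J"
    and f: "\<And>i. i \<in> J - {k} \<Longrightarrow> \<exists>N. f i ^ N \<in> \<beta>" "prod f (J - {k}) \<notin> \<beta>"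
  shows "\<exists>x. prod x J \<in> \<beta> \<and> (\<forall>j\<in>J. prod x (J - {j}) \<notin> \<beta>)"
proof -
  have "\<not> absorbing (card (J - {k})) \<beta>"
    using absorbing_radical_prod[OF \<beta>, of "J - {k}" f] f J(1) by blast
  moreover have "card J = Suc (card (J - {k}))" using J by (rule card.remove)
  ultimately show ?thesis using not_absorbing_family[OF _ J(1), of _ \<beta>] by metis
qed

lemma rideal_scalar_vimage: "rideal \<beta> \<Longrightarrow> rideal {r. u * r \<in> \<beta>}"
  by (auto simp: rideal_def distrib_left mult.left_commute[of u])

text \<open>
  A witness for \<open>N\<close> is a socle element at \<open>N\<close> that is a product of one factor fewer from \<open>N\<close> than there
  are indices \<open>l\<close> with \<open>M l = N\<close>. A single witness for each \<open>N\<close> suffices, whereas one for each \<open>k\<close>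
  would not be available after generic choices over finite fields.
\<close>

lemma cofinite_blocks:
  fixes M :: "nat \<Rightarrow> 'a::comm_ring_1 set"
  assumes \<beta>: "cofinite_ideal \<beta>" and K: "finite K" "K \<noteq> {}"
    and M: "\<And>k. k \<in> K \<Longrightarrow> finite_residue_prime (M k)"
    and witness: "\<And>N. N \<in> M ` K \<Longrightarrow> \<exists>k f a. k \<in> K \<and> M k = N \<and> (\<forall>i\<in>K. i \<noteq> k \<longrightarrow> f i \<in> M i) \<and>
      a * prod f (K - {k}) \<notin> \<beta> \<and> (\<forall>m\<in>N. m * (a * prod f (K - {k})) \<in> \<beta>)"
  shows "\<exists>x. prod x K \<in> \<beta> \<and> (\<forall>j\<in>K. prod x (K - {j}) \<notin> \<beta>)"
proof -
  have r\<beta>: "rideal \<beta>" using \<beta> by blast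
  have frp: "finite_residue_prime N" if "N \<in> M ` K" for N using M that by blast
  define Q where "Q N k f a \<longleftrightarrow> k \<in> K \<and> M k = N \<and> (\<forall>i\<in>K. i \<noteq> k \<longrightarrow> f i \<in> M i) \<and>
      a * prod f (K - {k}) \<notin> \<beta> \<and> (\<forall>m\<in>N. m * (a * prod f (K - {k})) \<in> \<beta>)" for N k f a
  have "\<forall>N\<in>M ` K. \<exists>k f a. Q N k f a" using witness unfolding Q_def by blast
  then obtain k f a where "\<And>N. N \<in> M ` K \<Longrightarrow> Q N (k N) (f N) (a N)" by metis
  then have w: "\<And>N. N \<in> M ` K \<Longrightarrow> k N \<in> K \<and> M (k N) = N"
    "\<And>N i. N \<in> M ` K \<Longrightarrow> i \<in> K \<Longrightarrow> i \<noteq> k N \<Longrightarrow> f N i \<in> M i"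
    "\<And>N. N \<in> M ` K \<Longrightarrow> a N * prod (f N) (K - {k N}) \<notin> \<beta>"
    "\<And>N m. N \<in> M ` K \<Longrightarrow> m \<in> N \<Longrightarrow> m * (a N * prod (f N) (K - {k N})) \<in> \<beta>"
    unfolding Q_def by blast+
  define c where "c N = a N * prod (f N) (K - {k N})" for N
  \<comment> \<open>An element of \<beta> outside \<open>N\<close> would be invertible modulo
    \<open>N\<close>; as \<open>N\<close> kills \<open>c N\<close> modulo \<beta>, this would put
    \<open>c N\<close> into \<beta>.\<close>
  have \<beta>N: "\<beta> \<subseteq> N" if N: "N \<in> M ` K" for N
  proof
    fix r assume r: "r \<in> \<beta>"
    show "r \<in> N"
    proof (rule ccontr)
      assume "r \<notin> N"
      then obtain b where "1 - b * r \<in> N" using frp_inverse[OF frp[OF N]] by blast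
      then have "(1 - b * r) * c N \<in> \<beta>" using w(4)[OF N] by (simp add: c_def)
      moreover have "b * r * c N \<in> \<beta>"
        by (intro rideal_mult_right[OF r\<beta>] rideal_mult[OF r\<beta>] r)
      ultimately have "(1 - b * r) * c N + b * r * c N \<in> \<beta>" by (rule rideal_add[OF r\<beta>])
      then show False using w(3)[OF N] by (simp add: left_diff_distrib c_def)
    qed
  qed
  have "\<forall>N\<in>M ` K. \<exists>e. e \<notin> N \<and> e * e - e \<in> \<beta> \<and> (\<forall>m\<in>N. \<exists>n. e * m ^ n \<in> \<beta>)"
    using local_idempotent[OF \<beta> frp \<beta>N] by metis
  then obtain u where u: "\<And>N. N \<in> M ` K \<Longrightarrow> u N \<notin> N" "\<And>N. N \<in> M ` K \<Longrightarrow> u N * u N - u N \<in> \<beta>"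
    "\<And>N m. N \<in> M ` K \<Longrightarrow> m \<in> N \<Longrightarrow> \<exists>n. u N * m ^ n \<in> \<beta>"
    by metis
  have orth: "u N * u L \<in> \<beta>" if "N \<in> M ` K" "L \<in> M ` K" "N \<noteq> L" for N L
    by (rule local_idempotents_orthogonal[OF r\<beta> frp \<beta>N frp]) (use that u in auto)
  \<comment> \<open>The kernel of the projection to the local factor at \<open>N\<close> that the
    idempotent \<open>u N\<close> cuts out.\<close>
  define \<beta>' where "\<beta>' N = {r. u N * r \<in> \<beta>}" for N
  have r\<beta>': "rideal (\<beta>' N)" for N
    unfolding \<beta>'_def by (rule rideal_scalar_vimage[OF r\<beta>])
  define J where "J N = {l \<in> K. M l = N}" for N
  have "\<exists>x. prod x (J N) \<in> \<beta>' N \<and> (\<forall>j\<in>J N. prod x (J N - {j}) \<notin> \<beta>' N)" if N: "N \<in> M ` K" for N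
  proof -
    have JN: "finite (J N)" "k N \<in> J N" using K(1) w(1)[OF N] by (auto simp: J_def)
    have nil: "\<exists>n. f N i ^ n \<in> \<beta>' N" if "i \<in> J N - {k N}" for i
      using that w(2)[OF N, of i] u(3)[OF N, of "f N i"] by (auto simp: J_def \<beta>'_def)
    \<comment> \<open>The factors outside the block can be ignored: \<open>1 - u N\<close> lies in
      \<open>N\<close> and kills \<open>c N\<close> modulo \<beta>, so \<open>u N * c N\<close>
      stays outside \<beta>.\<close>
    have "prod (f N) (J N - {k N}) \<notin> \<beta>' N"
    proof
      assume "prod (f N) (J N - {k N}) \<in> \<beta>' N"
      then have 1: "u N * prod (f N) (J N - {k N}) \<in> \<beta>" by (simp add: \<beta>'_def)
      have "prod (f N) ((J N - {k N}) \<union> (K - J N)) = prod (f N) (J N - {k N}) * prod (f N) (K - J N)"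
        using K(1) JN(1) by (intro prod.union_disjoint) auto
      moreover have "(J N - {k N}) \<union> (K - J N) = K - {k N}" using JN by (auto simp: J_def)
      ultimately have "prod (f N) (K - {k N}) = prod (f N) (J N - {k N}) * prod (f N) (K - J N)"
        by metis
      then have "u N * c N = a N * prod (f N) (K - J N) * (u N * prod (f N) (J N - {k N}))"
        by (simp add: c_def ac_simps)
      then have 2: "u N * c N \<in> \<beta>" using rideal_mult[OF r\<beta> 1] by simp
      have "u N * (1 - u N) \<in> N"
        using rideal_minus[OF r\<beta> u(2)[OF N]] \<beta>N[OF N] by (auto simp: algebra_simps)
      then have "1 - u N \<in> N" using frp_prime[OF frp[OF N]] u(1)[OF N] by blast
      then have "(1 - u N) * c N \<in> \<beta>" using w(4)[OF N] by (simp add: c_def)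
      from rideal_add[OF r\<beta> this 2] show False using w(3)[OF N] by (simp add: c_def left_diff_distrib)
    qed
    with r\<beta>' JN nil show ?thesis by (rule radical_block)
  qed
  then have "\<forall>N\<in>M ` K. \<exists>x. prod x (J N) \<in> \<beta>' N \<and> (\<forall>j\<in>J N. prod x (J N - {j}) \<notin> \<beta>' N)"
    by blast
  then obtain x where x: "\<And>N. N \<in> M ` K \<Longrightarrow> prod (x N) (J N) \<in> \<beta>' N"
    "\<And>N j. N \<in> M ` K \<Longrightarrow> j \<in> J N \<Longrightarrow> prod (x N) (J N - {j}) \<notin> \<beta>' N"
    by metis
  \<comment> \<open>Gluing along the idempotents: \<open>z l\<close> has component
    \<open>x (M l) l\<close> in its own block and 1 in all others, which \<open>w\<close>
    records.\<close>
  define z where "z l = u (M l) * x (M l) l + (\<Sum>N\<in>M ` K - {M l}. u N)" for l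
  define w where "w N l = (if M l = N then x N l else 1)" for N l
  have zw: "z l - w N l \<in> \<beta>' N" if N: "N \<in> M ` K" and l: "l \<in> K" for N l
  proof (cases "M l = N")
    case True
    have "(\<Sum>L\<in>M ` K - {N}. u N * u L) \<in> \<beta>" by (intro rideal_sum[OF r\<beta>] orth N) blast+
    from rideal_add[OF r\<beta> rideal_mult_right[OF r\<beta> u(2)[OF N], of "x N l"] this]
    show ?thesis by (simp add: True z_def w_def \<beta>'_def algebra_simps sum_distrib_left)
  next
    case False
    have "(\<Sum>L\<in>M ` K - {M l}. u L) = u N + (\<Sum>L\<in>M ` K - {M l} - {N}. u L)"
      using False N K(1) by (intro sum.remove) auto
    then have "u N * (z l - w N l) = u N * u (M l) * x (M l) l + (u N * u N - u N)
        + (\<Sum>L\<in>M ` K - {M l} - {N}. u N * u L)"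
      using False by (simp add: z_def w_def algebra_simps sum_distrib_left)
    also have "\<dots> \<in> \<beta>"
    proof (intro rideal_add[OF r\<beta>])
      show "u N * u (M l) * x (M l) l \<in> \<beta>"
        using False l by (intro rideal_mult_right[OF r\<beta>] orth N) (simp_all add: eq_commute)
      show "(\<Sum>L\<in>M ` K - {M l} - {N}. u N * u L) \<in> \<beta>"
        by (intro rideal_sum[OF r\<beta>] orth N) (blast+)
    qed (rule u(2)[OF N])
    finally show ?thesis by (simp add: \<beta>'_def)
  qed
  have prod_iff: "prod z S \<in> \<beta>' N \<longleftrightarrow> prod (x N) (S \<inter> J N) \<in> \<beta>' N"
    if N: "N \<in> M ` K" and S: "S \<subseteq> K" for N S
  proof -
    have "prod z S - prod (w N) S \<in> \<beta>' N"
      using zw[OF N] S by (intro rideal_prod_diff[OF r\<beta>']) auto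
    moreover have "prod (w N) S = prod (x N) (S \<inter> J N)"
    proof -
      have "prod (w N) S = prod (w N) (S \<inter> J N)"
        using S K(1) finite_subset by (intro prod.mono_neutral_right) (auto simp: w_def J_def)
      also have "\<dots> = prod (x N) (S \<inter> J N)" by (intro prod.cong) (auto simp: w_def J_def)
      finally show ?thesis .
    qed
    ultimately show ?thesis using rideal_diff_iff[OF r\<beta>'] by metis
  qed
  have "prod z K \<in> \<beta>"
  proof -
    obtain l where l: "l \<in> K" using K(2) by blast
    \<comment> \<open>\<beta> may lie in further primes, so \<open>U\<close> need not be 1 modulo
      \<beta>; it acts as 1 on \<open>z l\<close>, which is a combination of the
      \<open>u N\<close>.\<close>
    define U where "U = (\<Sum>N\<in>M ` K. u N)"
    have "(\<Sum>N\<in>M ` K. u N * w N l) = u (M l) * w (M l) l + (\<Sum>N\<in>M ` K - {M l}. u N * w N l)"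
      using l K(1) by (intro sum.remove) auto
    also have "\<dots> = z l"
      unfolding z_def by (intro arg_cong2[of _ _ _ _ "(+)"] sum.cong) (auto simp: w_def)
    finally have "U * z l - z l = (\<Sum>N\<in>M ` K. u N * (z l - w N l))"
      by (simp add: U_def sum_distrib_right right_diff_distrib sum_subtractf)
    also have "\<dots> \<in> \<beta>"
      using zw l by (intro rideal_sum[OF r\<beta>]) (auto simp: \<beta>'_def)
    finally have "(U * z l - z l) * prod z (K - {l}) \<in> \<beta>" by (rule rideal_mult_right[OF r\<beta>])
    moreover have "prod z K = z l * prod z (K - {l})" using l K(1) by (intro prod.remove) auto
    ultimately have "U * prod z K - prod z K \<in> \<beta>" by (simp add: algebra_simps)
    moreover have "U * prod z K \<in> \<beta>"
      unfolding U_def sum_distrib_right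
    proof (intro rideal_sum[OF r\<beta>])
      fix N assume N: "N \<in> M ` K"
      have "K \<inter> J N = J N" by (auto simp: J_def)
      then show "u N * prod z K \<in> \<beta>" using prod_iff[OF N, of K] x(1)[OF N] by (simp add: \<beta>'_def)
    qed
    ultimately show ?thesis using rideal_diff_iff[OF r\<beta>] by blast
  qed
  moreover have "prod z (K - {j}) \<notin> \<beta>" if j: "j \<in> K" for j
  proof
    assume "prod z (K - {j}) \<in> \<beta>"
    then have "prod z (K - {j}) \<in> \<beta>' (M j)" by (simp add: \<beta>'_def rideal_mult[OF r\<beta>])
    moreover have "(K - {j}) \<inter> J (M j) = J (M j) - {j}" by (auto simp: J_def)
    ultimately show False using prod_iff[of "M j" "K - {j}"] x(2)[of "M j" j] j by (auto simp: J_def)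
  qed
  ultimately show ?thesis by blast
qed

section \<open>Families of ideals with product in an absorbing ideal\<close>

context fin_gen_ring
begin

text \<open>The classical associated prime: among the multiples \<open>s\<close> of \<open>X\<close>
  that are nonzero modulo \<alpha>, one with maximal annihilator has a prime annihilator. A maximal
  one exists because all annihilators contain the cofinite \<open>colon X\<close>.\<close>

lemma ex_annihilator_prime:
  assumes X: "finite_index (colon X) UNIV" "\<not> X \<subseteq> \<alpha>"
  obtains s where "finite_residue_prime (colon (pointwise_prod {s} X))"
proof -
  define P where "P s \<longleftrightarrow> (\<exists>x\<in>X. s * x \<notin> \<alpha>)" for s
  define F where "F s = colon (pointwise_prod {s} X)" for s
  have memF: "r \<in> F s' \<longleftrightarrow> (\<forall>x\<in>X. r * (s' * x) \<in> \<alpha>)" for r s'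
    by (auto simp: F_def colon_pointwise_prod)
  have "colon X \<subseteq> F s" for s
    using rideal_mult[OF rideal_\<alpha>, of _ s] by (auto simp: memF colon_def mult.left_commute[of _ s])
  then have F: "rideal (F s) \<and> colon X \<subseteq> F s" for s
    using rideal_colon by (simp add: F_def)
  have P1: "P 1" using X(2) by (auto simp: P_def)
  obtain s where s: "P s" "\<And>s'. P s' \<Longrightarrow> F s \<subseteq> F s' \<Longrightarrow> F s' \<subseteq> F s"
    by (rule cofinite_maximal_choice[of "colon X" P 1 F]) (use X(1) P1 F in blast)+
  have "a \<in> F s \<or> b \<in> F s" if ab: "a * b \<in> F s" for a b
  proof (cases "P (a * s)")
    case True
    have "F s \<subseteq> F (a * s)"
      using rideal_mult[OF rideal_\<alpha>, of _ a] by (auto simp: memF mult.assoc mult.left_commute[of _ a])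
    moreover have "b \<in> F (a * s)" using ab by (auto simp: memF ac_simps)
    ultimately show ?thesis using s(2)[OF True] by blast
  qed (auto simp: P_def memF mult.assoc)
  moreover have "1 \<notin> F s" using s(1) by (auto simp: P_def memF)
  moreover have "finite_index (F s) UNIV" using F X(1) finite_index_mono by blast
  ultimately have "finite_residue_prime (F s)" using F by (auto simp: finite_residue_prime_def)
  then show thesis using that unfolding F_def by blast
qed

text \<open>The \<open>b t\<close> are exchanged for the \<open>a t\<close> one at a time. Each
  exchange alters the product by \<open>a t - b t\<close> times \<open>c\<close> times a product
  over the other indices, which lies in \<alpha>.\<close>

lemma prod_congruent:
  assumes E: "finite E" and ab: "\<And>t. t \<in> E \<Longrightarrow> a t \<in> \<gamma> t" "\<And>t. t \<in> E \<Longrightarrow> b t \<in> \<gamma> t"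
    and d: "\<And>t. t \<in> E \<Longrightarrow> a t - b t \<in> colon ((*) c ` family_prods \<gamma> (E - {t}))"
  shows "c * prod a E - c * prod b E \<in> \<alpha>"
proof -
  define h where "h S i = (if i \<in> S then a i else b i)" for S i
  have "c * prod (h S) E - c * prod b E \<in> \<alpha>" if "finite S" "S \<subseteq> E" for S
    using that
  proof (induction S)
    case empty
    then show ?case by (simp add: h_def rideal_0[OF rideal_\<alpha>])
  next
    case (insert t S)
    let ?q = "prod (h S) (E - {t})"
    have t: "t \<in> E" "t \<notin> S" using insert by auto
    have "?q \<in> family_prods \<gamma> (E - {t})" using ab by (intro family_prodsI) (auto simp: h_def)
    then have "(a t - b t) * (c * ?q) \<in> \<alpha>" using d[OF t(1)] by (auto simp: colon_def)
    moreover have "prod (h S) E = b t * ?q" using t E by (simp add: prod.remove[of E t] h_def)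
    moreover have "prod (h (insert t S)) E = a t * ?q"
    proof -
      have "prod (h (insert t S)) (E - {t}) = ?q" by (intro prod.cong) (auto simp: h_def)
      then show ?thesis using t(1) E by (simp add: prod.remove[of E t] h_def)
    qed
    moreover have "c * prod (h S) E - c * prod b E \<in> \<alpha>" using insert by blast
    ultimately have "(a t - b t) * (c * ?q) + (c * (b t * ?q) - c * prod b E) \<in> \<alpha>"
      by (intro rideal_add[OF rideal_\<alpha>]) auto
    then show ?case
      using \<open>prod (h (insert t S)) E = a t * ?q\<close> by (simp add: algebra_simps)
  qed
  from this[OF E order_refl] show ?thesis by (simp add: h_def)
qed

text \<open>A counterexample to strong absorption, subject to the finiteness conditions that the
  index arguments require.\<close>

definition minimal_zero_family :: "nat set \<Rightarrow> (nat \<Rightarrow> 'a set) \<Rightarrow> bool"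
  where "minimal_zero_family I \<gamma> \<longleftrightarrow> (\<forall>i\<in>I. rideal (\<gamma> i) \<and> \<alpha> \<subseteq> \<gamma> i \<and> fin_gen (\<gamma> i)) \<and>
    family_prods \<gamma> I \<subseteq> \<alpha> \<and> (\<forall>j\<in>I. \<not> family_prods \<gamma> (I - {j}) \<subseteq> \<alpha>)"

lemma family_prods_remove:
  assumes "finite I" "k \<in> I"
  shows "family_prods \<gamma> I = pointwise_prod (\<gamma> k) (family_prods \<gamma> (I - {k}))"
  using family_prods_insert[of "I - {k}" k \<gamma>] assms by (simp add: insert_absorb)

text \<open>Replacing one \<open>\<delta> k\<close> by \<open>colon (family_prods \<delta> (I - {k}))\<close> keeps the family a minimal zero family.\<close>

lemma saturate_family:
  assumes I: "finite I" and \<gamma>: "minimal_zero_family I \<gamma>"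
  obtains \<delta> where "minimal_zero_family I \<delta>"
    "\<And>k. k \<in> I \<Longrightarrow> finite_index (colon (family_prods \<delta> (I - {k}))) UNIV \<Longrightarrow> finite_index (\<delta> k) UNIV"
proof -
  \<comment> \<open>In a family with the most cofinite members, a replacement that yields a cofinite
    ideal can occur only where the member was cofinite already.\<close>
  define m where "m \<delta> = card {k \<in> I. finite_index (\<delta> k) UNIV}" for \<delta> :: "nat \<Rightarrow> 'a set"
  have "\<forall>\<delta>. minimal_zero_family I \<delta> \<longrightarrow> m \<delta> < Suc (card I)"
    using I by (auto simp: m_def less_Suc_eq_le intro: card_mono)
  from ex_has_greatest_nat[of "minimal_zero_family I", OF \<gamma> this] obtain \<delta>
    where \<delta>: "minimal_zero_family I \<delta>" "\<And>\<epsilon>. minimal_zero_family I \<epsilon> \<Longrightarrow> m \<epsilon> \<le> m \<delta>" by blast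
  show thesis
  proof (rule that[OF \<delta>(1)])
    fix k assume k: "k \<in> I" and fin: "finite_index (colon (family_prods \<delta> (I - {k}))) UNIV"
    define C where "C = colon (family_prods \<delta> (I - {k}))"
    define \<epsilon> where "\<epsilon> = \<delta>(k := C)"
    have zero: "pointwise_prod (\<delta> k) (family_prods \<delta> (I - {k})) \<subseteq> \<alpha>"
      using \<delta>(1) by (simp add: minimal_zero_family_def flip: family_prods_remove[OF I k])
    have sub: "\<delta> k \<subseteq> C"
      using zero by (force simp: C_def colon_def pointwise_prod_def)
    have same: "family_prods \<epsilon> (I - {k}) = family_prods \<delta> (I - {k})"
      by (intro family_prods_cong) (simp add: \<epsilon>_def)
    have "fin_gen C" unfolding C_def
      using fin rideal_colon \<alpha>_subset_colon by (intro cofinite_fin_gen) auto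
    then have "\<forall>i\<in>I. rideal (\<epsilon> i) \<and> \<alpha> \<subseteq> \<epsilon> i \<and> fin_gen (\<epsilon> i)"
      using \<delta>(1) rideal_colon \<alpha>_subset_colon by (auto simp: minimal_zero_family_def \<epsilon>_def C_def)
    moreover have "family_prods \<epsilon> I \<subseteq> \<alpha>"
      unfolding family_prods_remove[OF I k] same
      by (auto simp: \<epsilon>_def C_def colon_def pointwise_prod_def)
    moreover have "\<not> family_prods \<epsilon> (I - {j}) \<subseteq> \<alpha>" if j: "j \<in> I" for j
    proof -
      have "family_prods \<delta> (I - {j}) \<subseteq> family_prods \<epsilon> (I - {j})"
        using sub by (intro family_prods_mono) (simp add: \<epsilon>_def)
      then show ?thesis using \<delta>(1) j unfolding minimal_zero_family_def by (meson order_trans)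
    qed
    ultimately have "m \<epsilon> \<le> m \<delta>" by (intro \<delta>(2)) (auto simp: minimal_zero_family_def)
    define S where "S = {i \<in> I. finite_index (\<delta> i) UNIV}"
    have "{i \<in> I. finite_index (\<epsilon> i) UNIV} = insert k S"
      using fin k by (auto simp: \<epsilon>_def C_def S_def)
    with \<open>m \<epsilon> \<le> m \<delta>\<close> have le: "card (insert k S) \<le> card S"
      unfolding m_def S_def[symmetric] by (simp only:)
    have "finite S" using I by (simp add: S_def)
    have "k \<in> S"
    proof (rule ccontr)
      assume "k \<notin> S"
      then show False using le card_insert_disjoint[OF \<open>finite S\<close>] by simp
    qed
    then show "finite_index (\<delta> k) UNIV" by (simp add: S_def)
  qed
qed

theorem absorbing_ideal_family:
  assumes abs: "absorbing n \<alpha>" and I: "finite I" "card I = Suc n"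
    and \<gamma>0: "minimal_zero_family I \<gamma>0"
  shows False
proof -
  obtain \<gamma> where \<gamma>: "minimal_zero_family I \<gamma>"
    "\<And>k. k \<in> I \<Longrightarrow> finite_index (colon (family_prods \<gamma> (I - {k}))) UNIV \<Longrightarrow> finite_index (\<gamma> k) UNIV"
    using saturate_family[OF I(1) \<gamma>0] by blast
  define X where "X S = family_prods \<gamma> S" for S
  have \<gamma>i: "rideal (\<gamma> i)" "\<alpha> \<subseteq> \<gamma> i" "fin_gen (\<gamma> i)" if "i \<in> I" for i
    using \<gamma>(1) that by (auto simp: minimal_zero_family_def)
  have zero: "X I \<subseteq> \<alpha>" and nonzero: "\<And>j. j \<in> I \<Longrightarrow> \<not> X (I - {j}) \<subseteq> \<alpha>"
    using \<gamma>(1) by (auto simp: minimal_zero_family_def X_def)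

  \<comment> \<open>Splitting of the indices and associated primes on the cofinite part\<close>
  define E where "E = {k \<in> I. \<not> finite_index (colon (X (I - {k}))) UNIV}"
  define K where "K = I - E"
  have EK: "E \<subseteq> I" "K \<subseteq> I" "E \<inter> K = {}" "E \<union> K = I" "finite E" "finite K"
    using I(1) by (auto simp: E_def K_def)
  have split: "prod h I = prod h E * prod h K" for h :: "nat \<Rightarrow> 'a"
    using prod.union_disjoint[OF EK(5,6,3), of h] EK(4) by simp
  have cofK: "finite_index (\<gamma> k) UNIV" "finite_index (colon (X (I - {k}))) UNIV" if "k \<in> K" for k
    using that \<gamma>(2)[of k] by (auto simp: K_def E_def X_def)
  have "\<forall>k\<in>K. \<exists>s. finite_residue_prime (colon (pointwise_prod {s} (X (I - {k}))))"
    using ex_annihilator_prime cofK(2) nonzero EK(2) by (metis subsetD)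
  then obtain s where s: "\<And>k. k \<in> K \<Longrightarrow> finite_residue_prime (colon (pointwise_prod {s k} (X (I - {k}))))"
    by metis
  \<comment> \<open>The prime contains \<open>\<gamma> k\<close>, since \<open>\<gamma> k\<close>
    times \<open>X (I - {k})\<close> lies in \<alpha>; elements of \<open>\<gamma> k\<close> can
    thus serve as the radical factors at this prime.\<close>
  define M where "M k = colon (pointwise_prod {s k} (X (I - {k})))" for k
  have frp: "finite_residue_prime (M k)" if "k \<in> K" for k using s that by (simp add: M_def)
  have memM: "r \<in> M k \<longleftrightarrow> (\<forall>x\<in>X (I - {k}). r * (s k * x) \<in> \<alpha>)" for r k
    by (auto simp: M_def colon_pointwise_prod)
  have \<gamma>M: "\<gamma> k \<subseteq> M k" if k: "k \<in> K" for k
  proof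
    fix g assume g: "g \<in> \<gamma> k"
    have "g * (s k * x) \<in> \<alpha>" if x: "x \<in> X (I - {k})" for x
    proof -
      have "g * x \<in> X I"
        using g x family_prods_remove[OF I(1), of k \<gamma>] k EK(2) by (auto simp: X_def pointwise_prod_def)
      then show ?thesis using rideal_mult[OF rideal_\<alpha>, of "g * x" "s k"] zero by (auto simp: ac_simps)
    qed
    then show "g \<in> M k" by (simp add: memM)
  qed
  have "\<exists>f. (\<forall>i\<in>I - {k}. f i \<in> \<gamma> i) \<and> s k * prod f (I - {k}) \<notin> \<alpha>" if "k \<in> K" for k
    using frp_one[OF frp[OF that]] unfolding memM X_def family_prods_def by auto
  then obtain F where F: "\<And>k i. k \<in> K \<Longrightarrow> i \<in> I - {k} \<Longrightarrow> F k i \<in> \<gamma> i"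
    "\<And>k. k \<in> K \<Longrightarrow> s k * prod (F k) (I - {k}) \<notin> \<alpha>"
    by metis
  \<comment> \<open>One index, and hence one witness, for each prime: several indices may share the
    same \<open>M k\<close>.\<close>
  define \<kappa> where "\<kappa> N = (SOME k. k \<in> K \<and> M k = N)" for N
  have \<kappa>: "\<kappa> N \<in> K" "M (\<kappa> N) = N" if "N \<in> M ` K" for N
  proof -
    have "\<exists>k. k \<in> K \<and> M k = N" using that by auto
    from someI_ex[OF this] show "\<kappa> N \<in> K" "M (\<kappa> N) = N" by (auto simp: \<kappa>_def)
  qed
  define f where "f N = F (\<kappa> N)" for N
  \<comment> \<open>\<open>c N\<close> times \<open>X E\<close> is killed by \<open>N\<close>, so a choice of elements for \<open>E\<close> only matters modulo \<open>N\<close> here,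
    and the conditions for different \<open>N\<close> are independent by the Chinese remainder theorem.\<close>
  define c where "c N = s (\<kappa> N) * prod (f N) (K - {\<kappa> N})" for N
  have remk: "prod h (I - {k}) = prod h E * prod h (K - {k})" if "k \<in> K" for h :: "nat \<Rightarrow> 'a" and k
  proof -
    have "I - {k} = E \<union> (K - {k})" using that EK by auto
    then show ?thesis using prod.union_disjoint[of E "K - {k}" h] EK by auto
  qed
  have f\<gamma>: "f N i \<in> \<gamma> i" if "N \<in> M ` K" "i \<in> I" "i \<noteq> \<kappa> N" for N i
    using F(1) \<kappa>(1) that by (simp add: f_def)
  have f\<gamma>E: "f N t \<in> \<gamma> t" if "N \<in> M ` K" "t \<in> E" for N t
    using f\<gamma>[OF that(1), of t] that(2) EK \<kappa>(1)[OF that(1)] by blast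
  have cf: "c N * prod (f N) E \<notin> \<alpha>" if N: "N \<in> M ` K" for N
    using F(2)[OF \<kappa>(1)[OF N]] remk[OF \<kappa>(1)[OF N], of "f N"] by (simp add: c_def f_def ac_simps)
  have Nc: "m * (c N * x) \<in> \<alpha>" if N: "N \<in> M ` K" and m: "m \<in> N" and x: "x \<in> X E" for N m x
  proof -
    let ?k = "\<kappa> N"
    have "prod (f N) (K - {?k}) \<in> X (K - {?k})"
      unfolding X_def using f\<gamma>[OF N] EK(2) by (intro family_prodsI) auto
    moreover have "X (I - {?k}) = pointwise_prod (X E) (X (K - {?k}))"
    proof -
      have "I - {?k} = E \<union> (K - {?k})" using \<kappa>(1)[OF N] EK by auto
      then show ?thesis using family_prods_Un[of E "K - {?k}" \<gamma>] EK by (auto simp: X_def)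
    qed
    ultimately have "x * prod (f N) (K - {?k}) \<in> X (I - {?k})" using x by (auto simp: pointwise_prod_def)
    moreover have "m \<in> M ?k" using m \<kappa>(2)[OF N] by simp
    ultimately have "m * (s ?k * (x * prod (f N) (K - {?k}))) \<in> \<alpha>" by (simp add: memM)
    then show ?thesis by (simp add: c_def ac_simps)
  qed

  \<comment> \<open>Generic elements for the indices in \<open>E\<close>\<close>
  have finMK: "finite (M ` K)" using EK(6) by simp
  have "\<forall>N\<in>M ` K. \<exists>e. 1 - e \<in> N \<and> (\<forall>L\<in>M ` K. L \<noteq> N \<longrightarrow> e \<in> L)"
  proof
    fix N assume N: "N \<in> M ` K"
    obtain e where "1 - e \<in> N" "\<And>L. L \<in> M ` K \<Longrightarrow> L \<noteq> N \<Longrightarrow> e \<in> L"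
      by (rule frp_separate[OF finMK _ N]) (use frp in blast)+
    then show "\<exists>e. 1 - e \<in> N \<and> (\<forall>L\<in>M ` K. L \<noteq> N \<longrightarrow> e \<in> L)" by blast
  qed
  then obtain e where e: "\<And>N. N \<in> M ` K \<Longrightarrow> 1 - e N \<in> N"
    "\<And>N L. N \<in> M ` K \<Longrightarrow> L \<in> M ` K \<Longrightarrow> L \<noteq> N \<Longrightarrow> e N \<in> L"
    by metis
  \<comment> \<open>The remainder theorem makes \<open>g0 t\<close> agree with \<open>f N t\<close>
    modulo \<open>HN N t\<close> for all \<open>N\<close> at once.\<close>
  define g0 where "g0 t = (\<Sum>N\<in>M ` K. e N * f N t)" for t
  define HN where "HN N t = colon ((*) (c N) ` X (E - {t}))" for N t
  \<comment> \<open>The changes at \<open>t\<close> that no witness notices modulo \<alpha>. The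
    intersection of the primes multiplies \<open>\<gamma> t\<close> into \<open>H t\<close>, whence
    the finite index.\<close>
  define H where "H t = {h \<in> \<gamma> t. \<forall>N\<in>M ` K. h \<in> HN N t}" for t
  have NH: "m * g \<in> HN N t" if N: "N \<in> M ` K" "m \<in> N" and "t \<in> E" "g \<in> \<gamma> t" for N m t g
  proof -
    have "m * g * (c N * x) \<in> \<alpha>" if x: "x \<in> X (E - {t})" for x
    proof -
      have "g * x \<in> X E"
        using x \<open>g \<in> \<gamma> t\<close> family_prods_remove[OF EK(5) \<open>t \<in> E\<close>, of \<gamma>] by (auto simp: X_def pointwise_prod_def)
      from Nc[OF N this] show ?thesis by (simp add: ac_simps)
    qed
    then show ?thesis by (auto simp: HN_def colon_def)
  qed
  have "\<exists>g. (\<forall>t\<in>E. g t - g0 t \<in> H t) \<and> (\<forall>k\<in>E. \<not> finite_index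
      (colon (family_prods (\<lambda>i. if i \<in> E then {g i} else \<gamma> i) (I - {k}))) UNIV)"
  proof (rule generic_elements[OF EK(5) I(1) EK(1,5)])
    fix t assume t: "t \<in> E"
    then have tI: "t \<in> I" using EK by blast
    have rH: "rideal (H t)" "\<alpha> \<subseteq> H t"
      using \<gamma>i[OF tI] rideal_colon \<alpha>_subset_colon unfolding H_def HN_def rideal_def by blast+
    have "finite_index (H t) (\<gamma> t)"
    proof (rule finite_index_fin_gen[OF _ \<gamma>i(3)[OF tI] rH])
      let ?C = "{r. \<forall>N\<in>M ` K. r \<in> N}"
      have "rideal ?C" using frp_rideal[OF frp] by (auto simp: rideal_def)
      moreover have "finite_index ?C UNIV"
        using frp_cofinite[OF frp] rideal_addgroup by (intro finite_index_INT finMK) blast+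
      ultimately show "cofinite_ideal ?C" ..
      fix r g assume "r \<in> ?C" "g \<in> \<gamma> t"
      then show "r * g \<in> H t" using NH[OF _ _ t] rideal_mult[OF \<gamma>i(1)[OF tI]] by (auto simp: H_def)
    qed
    moreover have "g0 t \<in> \<gamma> t"
      unfolding g0_def using f\<gamma>E t
      by (intro rideal_sum[OF \<gamma>i(1)[OF tI]] rideal_mult[OF \<gamma>i(1)[OF tI]]) auto
    ultimately show "rideal (\<gamma> t) \<and> fin_gen (\<gamma> t) \<and> H t \<subseteq> \<gamma> t \<and> finite_index (H t) (\<gamma> t) \<and> g0 t \<in> \<gamma> t"
      using \<gamma>i[OF tI] by (auto simp: H_def)
  qed (auto simp: E_def X_def)
  then obtain g where g: "\<And>t. t \<in> E \<Longrightarrow> g t - g0 t \<in> H t"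
    "\<And>k. k \<in> E \<Longrightarrow> \<not> finite_index
      (colon (family_prods (\<lambda>i. if i \<in> E then {g i} else \<gamma> i) (I - {k}))) UNIV"
    by blast
  have gf: "g t - f N t \<in> HN N t" if t: "t \<in> E" and N: "N \<in> M ` K" for t N
  proof -
    have rHN: "rideal (HN N t)" unfolding HN_def by (rule rideal_colon)
    have "g0 t = e N * f N t + (\<Sum>L\<in>M ` K - {N}. e L * f L t)"
      unfolding g0_def by (rule sum.remove[OF finMK N])
    then have "g t - f N t = (g t - g0 t) + (\<Sum>L\<in>M ` K - {N}. e L * f L t) - (1 - e N) * f N t"
      by (simp add: algebra_simps)
    also have "\<dots> \<in> HN N t"
    proof (rule rideal_diff[OF rHN rideal_add[OF rHN]])
      show "g t - g0 t \<in> HN N t" using g(1)[OF t] N unfolding H_def by blast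
      show "(1 - e N) * f N t \<in> HN N t" by (intro NH N e(1) t f\<gamma>E)
      show "(\<Sum>L\<in>M ` K - {N}. e L * f L t) \<in> HN N t"
        by (rule rideal_sum[OF rHN], rule NH) (use N e(2) t f\<gamma>E in blast)+
    qed
    finally show ?thesis .
  qed
  have g\<gamma>: "g t \<in> \<gamma> t" if t: "t \<in> E" for t
  proof -
    have tI: "t \<in> I" using t EK by blast
    have "g0 t \<in> \<gamma> t"
      unfolding g0_def using f\<gamma>E t
      by (intro rideal_sum[OF \<gamma>i(1)[OF tI]] rideal_mult[OF \<gamma>i(1)[OF tI]]) auto
    then show ?thesis using g(1)[OF t] rideal_diff_iff[OF \<gamma>i(1)[OF tI]] by (auto simp: H_def)
  qed
  define y where "y = prod g E"
  have yX: "y \<in> X E" unfolding y_def X_def using g\<gamma> by (intro family_prodsI)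
  have cy: "c N * y \<notin> \<alpha>" if N: "N \<in> M ` K" for N
  proof -
    have "c N * prod g E - c N * prod (f N) E \<in> \<alpha>"
      using gf[OF _ N] unfolding HN_def X_def
      by (intro prod_congruent[OF EK(5), where \<gamma> = \<gamma>]) (simp_all add: g\<gamma> f\<gamma>E[OF N])
    then show ?thesis using cf[OF N] rideal_diff_iff[OF rideal_\<alpha>] unfolding y_def by blast
  qed

  \<comment> \<open>Elements for the indices in \<open>K\<close>, modulo the annihilator of
    \<open>y\<close>\<close>
  define \<beta> where "\<beta> = colon {y}"
  have mem\<beta>: "r \<in> \<beta> \<longleftrightarrow> r * y \<in> \<alpha>" for r by (simp add: \<beta>_def colon_def)
  have r\<beta>: "rideal \<beta>" "\<alpha> \<subseteq> \<beta>" unfolding \<beta>_def by (rule rideal_colon \<alpha>_subset_colon)+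
  have XK: "X K \<subseteq> \<beta>"
  proof
    fix x assume "x \<in> X K"
    then have "y * x \<in> X I"
      using yX family_prods_Un[OF EK(5,6,3), of \<gamma>] EK(4) by (auto simp: X_def pointwise_prod_def)
    then show "x \<in> \<beta>" using zero by (auto simp: mem\<beta> mult.commute)
  qed
  have "cofinite_ideal (\<gamma> l) \<and> \<alpha> \<subseteq> \<gamma> l" if "l \<in> K" for l
    using cofK(1)[OF that] \<gamma>i[of l] EK(2) that by auto
  \<comment> \<open>The saturated members \<open>\<gamma> l\<close> with \<open>l \<in> K\<close>
    are cofinite, and \<beta> contains their products.\<close>
  then have cof\<beta>: "cofinite_ideal \<beta>"
    using XK cofinite_family_prods[OF EK(6) _ r\<beta>, of \<gamma>] r\<beta>(1) unfolding X_def by blast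
  have "\<exists>x. prod x K \<in> \<beta> \<and> (\<forall>j\<in>K. prod x (K - {j}) \<notin> \<beta>)"
  proof (cases "K = {}")
    case True
    then have "1 \<in> X K" by (simp add: X_def family_prods_def)
    then show ?thesis using XK True by auto
  next
    case False
    show ?thesis
    proof (rule cofinite_blocks[OF cof\<beta> EK(6) False frp])
      fix N assume N: "N \<in> M ` K"
      have "c N \<notin> \<beta>" using cy[OF N] by (simp add: mem\<beta>)
      moreover have "\<forall>m\<in>N. m * c N \<in> \<beta>" using Nc[OF N _ yX] by (simp add: mem\<beta> mult.assoc)
      moreover have "\<forall>i\<in>K. i \<noteq> \<kappa> N \<longrightarrow> f N i \<in> M i" using f\<gamma>[OF N] \<gamma>M EK(2) by blast
      ultimately show "\<exists>k f a. k \<in> K \<and> M k = N \<and> (\<forall>i\<in>K. i \<noteq> k \<longrightarrow> f i \<in> M i) \<and>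
          a * prod f (K - {k}) \<notin> \<beta> \<and> (\<forall>m\<in>N. m * (a * prod f (K - {k})) \<in> \<beta>)"
        using \<kappa>[OF N] unfolding c_def by blast
    qed
  qed
  then obtain x0 where x0: "prod x0 K \<in> \<beta>" "\<And>j. j \<in> K \<Longrightarrow> prod x0 (K - {j}) \<notin> \<beta>" by blast
  \<comment> \<open>The elements \<open>x0\<close> need not come from the \<open>\<gamma> k\<close>,
    so these are enlarged to the whole ring, which preserves infinite index. Generic representatives
    of \<open>x0\<close> modulo \<beta> then handle the omission of an index in
    \<open>E\<close>.\<close>
  define \<delta> where "\<delta> i = (if i \<in> E then {g i} else UNIV)" for i
  have "\<exists>x. (\<forall>t\<in>K. x t - x0 t \<in> \<beta>) \<and> (\<forall>k\<in>E. \<not> finite_index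
      (colon (family_prods (\<lambda>i. if i \<in> K then {x i} else \<delta> i) (I - {k}))) UNIV)"
  proof (rule generic_elements[OF EK(6) I(1) EK(2,5)])
    fix t assume "t \<in> K"
    then have "\<delta> t = UNIV" using EK by (auto simp: \<delta>_def)
    then show "rideal (\<delta> t) \<and> fin_gen (\<delta> t) \<and> \<beta> \<subseteq> \<delta> t \<and> finite_index \<beta> (\<delta> t) \<and> x0 t \<in> \<delta> t"
      using rideal_UNIV fin_gen_UNIV cof\<beta> by simp
  next
    fix k assume k: "k \<in> E"
    have "family_prods (\<lambda>i. if i \<in> E then {g i} else \<gamma> i) (I - {k}) \<subseteq> family_prods \<delta> (I - {k})"
      by (intro family_prods_mono) (auto simp: \<delta>_def)
    then show "\<not> finite_index (colon (family_prods \<delta> (I - {k}))) UNIV"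
      using g(2)[OF k] by (rule not_cofinite_colon_mono)
  qed
  then obtain x where x: "\<And>t. t \<in> K \<Longrightarrow> x t - x0 t \<in> \<beta>"
    "\<And>k. k \<in> E \<Longrightarrow> \<not> finite_index
      (colon (family_prods (\<lambda>i. if i \<in> K then {x i} else \<delta> i) (I - {k}))) UNIV"
    by blast
  have x\<beta>: "prod x S \<in> \<beta> \<longleftrightarrow> prod x0 S \<in> \<beta>" if "S \<subseteq> K" for S
    using that x(1) by (intro rideal_diff_iff[OF r\<beta>(1)] rideal_prod_diff[OF r\<beta>(1)]) auto
  define z where "z i = (if i \<in> K then x i else g i)" for i
  have zE: "prod z E = y" unfolding y_def by (intro prod.cong) (use EK in \<open>auto simp: z_def\<close>)
  have zK: "prod z S = prod x S" if "S \<subseteq> K" for S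
    by (intro prod.cong) (use that in \<open>auto simp: z_def\<close>)
  have "prod z I \<in> \<alpha>"
    using x0(1) x\<beta>[of K] by (simp add: split zE zK mem\<beta> mult.commute)
  then obtain j where j: "j \<in> I" "prod z (I - {j}) \<in> \<alpha>"
    using absorbing_family[OF abs I] by blast
  \<comment> \<open>Omitting an index of \<open>K\<close> contradicts the choice of
    \<open>x0\<close> modulo \<beta>. Omitting one of \<open>E\<close> would put the whole singleton
    product into \<alpha>, making its colon ideal cofinite.\<close>
  show False
  proof (cases "j \<in> K")
    case True
    have "prod z (I - {j}) = y * prod x (K - {j})" using remk[OF True] zE zK by auto
    then have "prod x (K - {j}) \<in> \<beta>" using j(2) by (simp add: mem\<beta> mult.commute)
    then show False using x0(2)[OF True] x\<beta>[of "K - {j}"] by blast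
  next
    case False
    then have jE: "j \<in> E" using j(1) EK by blast
    have "family_prods (\<lambda>i. if i \<in> K then {x i} else \<delta> i) (I - {j}) \<subseteq> \<alpha>"
    proof
      fix w assume "w \<in> family_prods (\<lambda>i. if i \<in> K then {x i} else \<delta> i) (I - {j})"
      then obtain h where h: "w = prod h (I - {j})"
        "\<And>i. i \<in> I - {j} \<Longrightarrow> h i \<in> (if i \<in> K then {x i} else \<delta> i)"
        unfolding family_prods_def by blast
      have "h i = z i" if "i \<in> I - {j}" for i
        using h(2)[OF that] that EK by (auto simp: z_def \<delta>_def split: if_splits)
      then have "w = prod z (I - {j})" unfolding h(1) by (intro prod.cong) auto
      then show "w \<in> \<alpha>" using j(2) by simp
    qed
    then show False using x(2)[OF jE] finite_index_colon_zero by blast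
  qed
qed

end

section \<open>Reduction to finitely generated rings\<close>

context cring
begin

lemma ideal_finprod_insert:
  assumes "finite S" "i \<notin> S" "\<And>k. k \<in> insert i S \<Longrightarrow> ideal (\<gamma> k) R"
  shows "finprod (ideals_set R) \<gamma> (insert i S) = \<gamma> i \<cdot> finprod (ideals_set R) \<gamma> S"
proof -
  interpret ISet: comm_monoid "ideals_set R" by (rule ideals_set_is_comm_monoid)
  have "carrier (ideals_set R) = {I. ideal I R}" "monoid.mult (ideals_set R) = ideal_prod R"
    by (simp_all add: ideals_set_def)
  then show ?thesis using assms ISet.finprod_insert[of S i \<gamma>] by auto
qed

lemma finprod_mem_ideal_finprod:
  assumes "finite S" "\<And>i. i \<in> S \<Longrightarrow> ideal (\<gamma> i) R" "\<And>i. i \<in> S \<Longrightarrow> f i \<in> \<gamma> i"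
  shows "finprod R f S \<in> finprod (ideals_set R) \<gamma> S"
proof -
  interpret ISet: comm_monoid "ideals_set R" by (rule ideals_set_is_comm_monoid)
  show ?thesis
    using assms
  proof (induction S)
    case empty
    show ?case unfolding ISet.finprod_empty by (simp add: ideals_set_def)
  next
    case (insert i S)
    have "f k \<in> carrier R" if "k \<in> insert i S" for k
      using insert.prems that by (meson ideal.Icarr)
    then have "finprod R f (insert i S) = f i \<otimes> finprod R f S"
      using insert.hyps by (intro finprod_insert) auto
    moreover have "finprod (ideals_set R) \<gamma> (insert i S) = \<gamma> i \<cdot> finprod (ideals_set R) \<gamma> S"
      using insert by (intro ideal_finprod_insert) auto
    ultimately show ?case using insert by (auto intro!: ideal_prod.prod)
  qed
qed

text \<open>An inclusion of a product of ideals can be tested on products of elements. For a fixed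
  first factor \<open>g\<close> the induction hypothesis is applied to the quotient
  \<open>(J : g)\<close>, which is why \<open>J\<close> is generalized.\<close>

lemma ideal_finprod_subset:
  assumes "finite S" "\<And>i. i \<in> S \<Longrightarrow> ideal (\<gamma> i) R" "ideal J R"
    and "\<And>f. (\<And>i. i \<in> S \<Longrightarrow> f i \<in> \<gamma> i) \<Longrightarrow> finprod R f S \<in> J"
  shows "finprod (ideals_set R) \<gamma> S \<subseteq> J"
proof -
  interpret ISet: comm_monoid "ideals_set R" by (rule ideals_set_is_comm_monoid)
  show ?thesis
    using assms
  proof (induction S arbitrary: J)
    case empty
    then have "\<one> \<in> J" by simp
    then have "J = carrier R" using empty.prems(2) ideal.one_imp_carrier by blast
    then show ?case unfolding ISet.finprod_empty by (simp add: ideals_set_def)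
  next
    case (insert i S)
    interpret J: ideal J R by (rule insert.prems(2))
    have "g \<otimes> p \<in> J" if g: "g \<in> \<gamma> i" and p: "p \<in> finprod (ideals_set R) \<gamma> S" for g p
    proof -
      have gR: "g \<in> carrier R" using g insert.prems(1) by (meson ideal.Icarr insertI1)
      let ?J = "{r \<in> carrier R. g \<otimes> r \<in> J}"
      have "ideal ?J R"
      proof (rule idealI)
        show "ring R" by (rule ring_axioms)
        show "subgroup ?J (add_monoid R)"
        proof (rule add.subgroupI)
          show "?J \<noteq> {}" using gR J.zero_closed by (auto intro!: exI[of _ \<zero>])
        qed (use gR in \<open>auto simp: r_distr r_minus simp flip: a_inv_def\<close>)
      next
        fix a x assume a: "a \<in> ?J" and x: "x \<in> carrier R"
        then have "x \<otimes> (g \<otimes> a) \<in> J" by (auto intro: J.I_l_closed)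
        then have "g \<otimes> (x \<otimes> a) \<in> J" using a x gR by (simp add: m_lcomm)
        then show "x \<otimes> a \<in> ?J" "a \<otimes> x \<in> ?J" using a x by (auto simp: m_comm)
      qed
      moreover have "finprod R f S \<in> ?J" if f: "\<And>k. k \<in> S \<Longrightarrow> f k \<in> \<gamma> k" for f
      proof -
        have fR: "f \<in> S \<rightarrow> carrier R" using f insert.prems(1) by (meson Pi_I ideal.Icarr insertI2)
        have "finprod R (f(i := g)) (insert i S) \<in> J"
          using f g insert.hyps by (intro insert.prems(3)) auto
        also have "finprod R (f(i := g)) (insert i S) = g \<otimes> finprod R (f(i := g)) S"
          using insert.hyps gR fR by (subst finprod_insert) auto
        also have "finprod R (f(i := g)) S = finprod R f S"
          using insert.hyps fR by (intro finprod_cong') auto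
        finally show ?thesis using fR by simp
      qed
      ultimately have "finprod (ideals_set R) \<gamma> S \<subseteq> ?J"
        using insert.prems(1) by (intro insert.IH) auto
      then show ?thesis using p by blast
    qed
    then have "\<gamma> i \<cdot> finprod (ideals_set R) \<gamma> S \<subseteq> J"
    proof (intro subsetI)
      fix x assume mem: "\<And>g p. g \<in> \<gamma> i \<Longrightarrow> p \<in> finprod (ideals_set R) \<gamma> S \<Longrightarrow> g \<otimes> p \<in> J"
        and "x \<in> \<gamma> i \<cdot> finprod (ideals_set R) \<gamma> S"
      from this(2) show "x \<in> J" by induction (auto intro: mem)
    qed
    moreover have "finprod (ideals_set R) \<gamma> (insert i S) = \<gamma> i \<cdot> finprod (ideals_set R) \<gamma> S"
      using insert by (intro ideal_finprod_insert) auto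
    ultimately show ?case by simp
  qed
qed

text \<open>Multisets serve as exponent vectors, and each variable indexed by \<open>Y\<close> is
  evaluated at its own index.\<close>

definition monomial :: "'a set \<Rightarrow> 'a multiset \<Rightarrow> 'a"
  where "monomial Y m = (\<Otimes>y\<in>Y. y [^] count m y)"

lemma monomial_simps:
  assumes "finite Y" "Y \<subseteq> carrier R"
  shows "monomial Y m \<in> carrier R"
    and "monomial Y {#} = \<one>"
    and "monomial Y (m + m') = monomial Y m \<otimes> monomial Y m'"
    and "y \<in> Y \<Longrightarrow> monomial Y {#y#} = y"
    and "y \<notin> Y \<Longrightarrow> monomial Y {#y#} = \<one>"
proof -
  have car: "y \<in> Y \<Longrightarrow> y \<in> carrier R" for y using assms(2) by blast
  show "monomial Y m \<in> carrier R"
    unfolding monomial_def using car by (intro finprod_closed) auto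
  show "monomial Y {#} = \<one>"
    unfolding monomial_def by (rule finprod_one_eqI) simp
  show "monomial Y (m + m') = monomial Y m \<otimes> monomial Y m'"
  proof -
    have "monomial Y (m + m') = (\<Otimes>y\<in>Y. y [^] count m y \<otimes> y [^] count m' y)"
      unfolding monomial_def using car by (intro finprod_cong') (auto simp: nat_pow_mult)
    also have "\<dots> = monomial Y m \<otimes> monomial Y m'"
      unfolding monomial_def using car by (intro finprod_multf) auto
    finally show ?thesis .
  qed
  show "y \<in> Y \<Longrightarrow> monomial Y {#y#} = y"
  proof -
    assume y: "y \<in> Y"
    have "monomial Y {#y#} = (\<Otimes>z\<in>Y. if y = z then z else \<one>)"
      unfolding monomial_def using car by (intro finprod_cong') auto
    also have "\<dots> = y" using y assms(1) car by (intro finprod_singleton) auto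
    finally show ?thesis .
  qed
  show "y \<notin> Y \<Longrightarrow> monomial Y {#y#} = \<one>"
    unfolding monomial_def by (rule finprod_one_eqI) auto
qed

text \<open>\<open>'a multiset \<Rightarrow>\<^sub>0 int\<close> is the polynomial ring over the integers in variables indexed by \<open>'a\<close>;
  variables outside \<open>Y\<close> are sent to \<open>\<one>\<close>, so that it is finitely generated modulo the kernel.\<close>

abbreviation var :: "'a \<Rightarrow> 'a multiset \<Rightarrow>\<^sub>0 int"
  where "var y \<equiv> frag_of {#y#}"

text \<open>The polynomial ring is the free abelian group on monomials, whose universal property
  gives the additive map; multiplicativity is checked on monomials and extended in each
  argument.\<close>

lemma ex_evaluation:
  assumes Y: "finite Y" "Y \<subseteq> carrier R"
  obtains \<phi> :: "('a multiset \<Rightarrow>\<^sub>0 int) \<Rightarrow> 'a" where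
    "\<And>p. \<phi> p \<in> carrier R" "\<And>p q. \<phi> (p + q) = \<phi> p \<oplus> \<phi> q" "\<And>p q. \<phi> (p * q) = \<phi> p \<otimes> \<phi> q"
    "\<phi> 1 = \<one>" "\<And>y. y \<in> Y \<Longrightarrow> \<phi> (var y) = y" "\<And>y. y \<notin> Y \<Longrightarrow> \<phi> (var y) = \<one>"
proof -
  have "range (monomial Y) \<subseteq> carrier (add_monoid R)"
    using monomial_simps(1)[OF Y] by auto
  then obtain \<phi> where \<phi>': "\<phi> \<in> hom (free_Abelian_group UNIV) (add_monoid R)"
    "\<And>m. m \<in> UNIV \<Longrightarrow> \<phi> (frag_of m) = monomial Y m"
    by (rule comm_group.free_Abelian_group_universal[OF a_comm_group]) auto
  then have \<phi>: "\<phi> \<in> hom (free_Abelian_group UNIV) (add_monoid R)"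
    "\<And>m. \<phi> (frag_of m) = monomial Y m" by auto
  have car: "\<phi> p \<in> carrier R" for p
    using \<phi>(1) by (auto simp: hom_def Pi_def)
  have add: "\<phi> (p + q) = \<phi> p \<oplus> \<phi> q" for p q
    using \<phi>(1) by (auto simp: hom_def)
  have zero: "\<phi> 0 = \<zero>" using add[of 0 0] car[of 0] by (simp add: add.l_cancel_one')
  have diff: "\<phi> (p - q) = \<phi> p \<ominus> \<phi> q" for p q
  proof -
    have "\<phi> p = \<phi> (p - q) \<oplus> \<phi> q" using add[of "p - q" q] by simp
    then show ?thesis using car by (simp add: a_minus_def a_assoc r_neg)
  qed
  have mult1: "\<phi> (frag_of m * q) = \<phi> (frag_of m) \<otimes> \<phi> q" for m q
  proof (rule frag_induction[of q UNIV])
    show "\<phi> (frag_of m * frag_of m') = \<phi> (frag_of m) \<otimes> \<phi> (frag_of m')" for m'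
      using monomial_simps[OF Y] by (simp add: mult_single \<phi>(2))
    show "\<phi> (frag_of m * (a - b)) = \<phi> (frag_of m) \<otimes> \<phi> (a - b)"
      if "\<phi> (frag_of m * a) = \<phi> (frag_of m) \<otimes> \<phi> a" "\<phi> (frag_of m * b) = \<phi> (frag_of m) \<otimes> \<phi> b" for a b
      using that car by (simp add: right_diff_distrib diff a_minus_def r_distr r_minus)
  qed (use car zero in auto)
  have mult: "\<phi> (p * q) = \<phi> p \<otimes> \<phi> q" for p q
  proof (rule frag_induction[of p UNIV])
    show "\<phi> ((a - b) * q) = \<phi> (a - b) \<otimes> \<phi> q"
      if "\<phi> (a * q) = \<phi> a \<otimes> \<phi> q" "\<phi> (b * q) = \<phi> b \<otimes> \<phi> q" for a b
      using that car by (simp add: left_diff_distrib diff a_minus_def l_distr l_minus)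
  qed (use car zero mult1 in auto)
  have "\<phi> 1 = \<one>" using \<phi>(2)[of "{#}"] monomial_simps(2)[OF Y] by simp
  with car add mult show thesis using \<phi>(2) monomial_simps(4,5)[OF Y] by (intro that[of \<phi>]) auto
qed

text \<open>A counterexample involves only finitely many elements \<open>f j i\<close>. Pulling
  \<alpha> back along the evaluation at these gives an absorbing ideal modulo which the polynomial
  ring is finitely generated, and the counterexample lifts to it.\<close>

lemma n_absorbing_imp_strongly:
  assumes n: "n_absorbing R n \<alpha>"
  shows "strongly_n_absorbing R n \<alpha>"
proof -
  have id\<alpha>: "ideal \<alpha> R" using n by (simp add: n_absorbing_def)
  define I where "I = {1..n + 1}"
  have I: "finite I" "card I = Suc n" by (simp_all add: I_def)
  have "\<exists>j\<in>I. finprod (ideals_set R) \<gamma> (I - {j}) \<subseteq> \<alpha>"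
    if \<gamma>: "\<And>i. i \<in> I \<Longrightarrow> ideal (\<gamma> i) R" and zero: "finprod (ideals_set R) \<gamma> I \<subseteq> \<alpha>" for \<gamma>
  proof (rule ccontr)
    assume neg: "\<not> ?thesis"
    have "\<exists>f. (\<forall>i\<in>I - {j}. f i \<in> \<gamma> i) \<and> finprod R f (I - {j}) \<notin> \<alpha>" if "j \<in> I" for j
      using ideal_finprod_subset[of "I - {j}" \<gamma> \<alpha>] I(1) \<gamma> id\<alpha> neg that by (metis Diff_iff finite_Diff)
    then obtain f where f: "\<And>j i. j \<in> I \<Longrightarrow> i \<in> I - {j} \<Longrightarrow> f j i \<in> \<gamma> i"
      "\<And>j. j \<in> I \<Longrightarrow> finprod R (f j) (I - {j}) \<notin> \<alpha>" by metis
    define Y where "Y = (\<lambda>(j, i). f j i) ` (SIGMA j:I. I - {j})"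
    have Y: "finite Y" "Y \<subseteq> carrier R"
      unfolding Y_def using I(1) f(1) \<gamma> by (auto dest: ideal.Icarr)
    obtain \<phi> :: "('a multiset \<Rightarrow>\<^sub>0 int) \<Rightarrow> 'a" where \<phi>:
      "\<And>p. \<phi> p \<in> carrier R" "\<And>p q. \<phi> (p + q) = \<phi> p \<oplus> \<phi> q" "\<And>p q. \<phi> (p * q) = \<phi> p \<otimes> \<phi> q"
      "\<phi> 1 = \<one>" "\<And>y. y \<in> Y \<Longrightarrow> \<phi> (var y) = y" "\<And>y. y \<notin> Y \<Longrightarrow> \<phi> (var y) = \<one>"
      using ex_evaluation[OF Y] by metis
    have \<phi>0: "\<phi> 0 = \<zero>" using \<phi>(2)[of 0 0] \<phi>(1)[of 0] by (simp add: add.l_cancel_one')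
    have \<phi>prod: "\<phi> (prod x S) = finprod R (\<lambda>i. \<phi> (x i)) S" if "finite S" for x and S :: "nat set"
      using that by (induction S) (auto simp: \<phi>)
    have vimage: "rideal (\<phi> -` J)" if "ideal J R" for J
    proof -
      interpret J: ideal J R by (rule that)
      show ?thesis by (auto simp: rideal_def \<phi> \<phi>0 J.I_l_closed)
    qed
    define \<alpha>' where "\<alpha>' = \<phi> -` \<alpha>"
    have r\<alpha>': "rideal \<alpha>'" unfolding \<alpha>'_def by (rule vimage[OF id\<alpha>])
    have abs: "absorbing n \<alpha>'"
      unfolding absorbing_def
    proof (intro allI impI)
      fix F :: "('a multiset \<Rightarrow>\<^sub>0 int) multiset"
      assume F: "size F = Suc n" "prod_mset F \<in> \<alpha>'"
      obtain x where x: "image_mset x (mset_set I) = F"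
        using ex_family_of_mset[OF I(1)] F(1) I(2) by metis
      have "prod x I \<in> \<alpha>'" using F(2) x by (simp add: prod_unfold_prod_mset)
      then have "finprod R (\<lambda>i. \<phi> (x i)) I \<in> \<alpha>" using \<phi>prod[OF I(1)] by (simp add: \<alpha>'_def)
      then obtain j where j: "j \<in> I" "finprod R (\<lambda>i. \<phi> (x i)) (I - {j}) \<in> \<alpha>"
        using n \<phi>(1) unfolding n_absorbing_def I_def by blast
      then have "prod x (I - {j}) \<in> \<alpha>'" using \<phi>prod[of "I - {j}"] I(1) by (simp add: \<alpha>'_def)
      then have "prod_mset (F - {#x j#}) \<in> \<alpha>'" using prod_mset_family_remove[OF I(1) j(1), of x] x by simp
      moreover have "x j \<in># F" using x j(1) I(1) by auto
      ultimately show "\<exists>f. f \<in># F \<and> prod_mset (F - {#f#}) \<in> \<alpha>'" by blast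
    qed
    interpret fin_gen_ring \<alpha>'
    proof
      show "rideal \<alpha>'" by (rule r\<alpha>')
      show "\<exists>Z. finite Z \<and> (\<forall>S. addgroup S \<longrightarrow> \<alpha>' \<subseteq> S \<longrightarrow> 1 \<in> S \<longrightarrow>
          (\<forall>y\<in>Z. \<forall>s\<in>S. y * s \<in> S) \<longrightarrow> S = UNIV)"
      proof (intro exI[of _ "var ` Y"] conjI allI impI)
        fix S assume S: "addgroup S" "\<alpha>' \<subseteq> S" "1 \<in> S" "\<forall>y\<in>var ` Y. \<forall>s\<in>S. y * s \<in> S"
        \<comment> \<open>A variable outside \<open>Y\<close> evaluates to 1, so it is congruent to
          1 modulo \<open>\<alpha>'\<close>.\<close>
        have mult: "var y * s \<in> S" if s: "s \<in> S" for y s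
        proof (cases "y \<in> Y")
          case False
          have "\<phi> (var y) = \<phi> (var y - 1) \<oplus> \<phi> 1" using \<phi>(2)[of "var y - 1" 1] by simp
          then have "\<phi> (var y - 1) = \<zero>" using \<phi>(1,4) \<phi>(6)[OF False] by (simp add: add.l_cancel_one')
          then have "var y - 1 \<in> \<alpha>'" using id\<alpha> by (simp add: \<alpha>'_def additive_subgroup.zero_closed ideal.axioms(1))
          then have "(var y - 1) * s \<in> S" using rideal_mult_right[OF r\<alpha>'] S(2) by blast
          from addgroup_add[OF S(1) this s] show ?thesis by (simp add: left_diff_distrib)
        qed (use s S(4) in blast)
        have frag: "frag_of m \<in> S" for m
        proof (induction m)
          case (add y m)
          have "frag_of (add_mset y m) = var y * frag_of m" by (simp add: mult_single)
          then show ?case using mult[OF add] by simp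
        qed (use S(3) in simp)
        have "p \<in> S" for p
          by (rule frag_induction[of p UNIV])
            (use frag addgroup_0[OF S(1)] addgroup_diff[OF S(1)] in auto)
        then show "S = UNIV" by blast
      qed (use Y(1) in simp)
    qed
    define B where "B i = (\<lambda>j. var (f j i)) ` (I - {i})" for i
    define \<delta> where "\<delta> i = \<Inter>{J. rideal J \<and> \<alpha>' \<subseteq> J \<and> B i \<subseteq> J}" for i
    have \<delta>: "rideal (\<delta> i)" "\<alpha>' \<subseteq> \<delta> i" "B i \<subseteq> \<delta> i" for i
      unfolding \<delta>_def by (auto simp: rideal_def)
    have fY: "\<phi> (var (f j i)) = f j i" if "j \<in> I" "i \<in> I" "i \<noteq> j" for i j
      using that by (intro \<phi>(5)) (force simp: Y_def)
    have "minimal_zero_family I \<delta>"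
      unfolding minimal_zero_family_def
    proof (intro conjI ballI)
      fix i assume "i \<in> I"
      show "fin_gen (\<delta> i)"
        unfolding fin_gen_def using I(1) \<delta>(3) by (intro exI[of _ "B i"]) (auto simp: B_def \<delta>_def)
    next
      show "family_prods \<delta> I \<subseteq> \<alpha>'"
      proof
        fix x assume "x \<in> family_prods \<delta> I"
        then obtain h where h: "x = prod h I" "\<And>i. i \<in> I \<Longrightarrow> h i \<in> \<delta> i"
          unfolding family_prods_def by blast
        \<comment> \<open>\<open>\<delta> i\<close> contains \<open>\<alpha>'\<close>, whose image
          need not lie in \<open>\<gamma> i\<close>; a correction by \<open>\<alpha>'\<close> is
          harmless for products tested modulo \<open>\<alpha>'\<close>.\<close>
        have "\<exists>b. \<phi> b \<in> \<gamma> i \<and> h i - b \<in> \<alpha>'" if i: "i \<in> I" for i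
        proof -
          let ?J = "{t. \<exists>b. \<phi> b \<in> \<gamma> i \<and> t - b \<in> \<alpha>'}"
          have r: "rideal (\<phi> -` \<gamma> i)" by (rule vimage[OF \<gamma>[OF i]])
          have "rideal ?J"
            unfolding rideal_def
          proof (intro conjI ballI allI)
            show "0 \<in> ?J" using rideal_0[OF r] rideal_0[OF r\<alpha>'] by (auto intro!: exI[of _ 0])
          next
            fix s t assume "s \<in> ?J" "t \<in> ?J"
            then obtain b c where "\<phi> b \<in> \<gamma> i" "s - b \<in> \<alpha>'" "\<phi> c \<in> \<gamma> i" "t - c \<in> \<alpha>'" by blast
            then show "s + t \<in> ?J"
              using rideal_add[OF r, of b c] rideal_add[OF r\<alpha>', of "s - b" "t - c"]
              by (auto intro!: exI[of _ "b + c"] simp: algebra_simps)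
          next
            fix u t assume "t \<in> ?J"
            then obtain c where "\<phi> c \<in> \<gamma> i" "t - c \<in> \<alpha>'" by blast
            then show "u * t \<in> ?J"
              using rideal_mult[OF r, of c u] rideal_mult[OF r\<alpha>', of "t - c" u]
              by (auto intro!: exI[of _ "u * c"] simp: algebra_simps)
          qed
          moreover have "\<alpha>' \<subseteq> ?J" using rideal_0[OF r] by (auto intro!: exI[of _ 0])
          moreover have "B i \<subseteq> ?J"
          proof
            fix b assume "b \<in> B i"
            then obtain j where "j \<in> I" "j \<noteq> i" "b = var (f j i)" by (auto simp: B_def)
            then have "\<phi> b \<in> \<gamma> i" using f(1)[of j i] fY i by simp
            then show "b \<in> ?J" using rideal_0[OF r\<alpha>'] by (intro CollectI exI[of _ b]) simp
          qed
          ultimately show ?thesis using h(2)[OF i] unfolding \<delta>_def by blast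
        qed
        then obtain b where b: "\<And>i. i \<in> I \<Longrightarrow> \<phi> (b i) \<in> \<gamma> i" "\<And>i. i \<in> I \<Longrightarrow> h i - b i \<in> \<alpha>'"
          by metis
        have "finprod R (\<lambda>i. \<phi> (b i)) I \<in> \<alpha>"
          using finprod_mem_ideal_finprod[of I \<gamma> "\<lambda>i. \<phi> (b i)"] I(1) \<gamma> b(1) zero by blast
        then have "prod b I \<in> \<alpha>'" using \<phi>prod[OF I(1)] by (simp add: \<alpha>'_def)
        moreover have "prod h I - prod b I \<in> \<alpha>'" using b(2) by (rule rideal_prod_diff[OF r\<alpha>'])
        ultimately show "x \<in> \<alpha>'" using rideal_diff_iff[OF r\<alpha>'] h(1) by blast
      qed
    next
      fix j assume j: "j \<in> I"
      have "(\<Prod>i\<in>I - {j}. var (f j i)) \<in> family_prods \<delta> (I - {j})"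
      proof (rule family_prodsI)
        fix i assume "i \<in> I - {j}"
        then have "var (f j i) \<in> B i" using j by (auto simp: B_def)
        then show "var (f j i) \<in> \<delta> i" using \<delta>(3) by blast
      qed
      moreover have "\<phi> (\<Prod>i\<in>I - {j}. var (f j i)) = finprod R (f j) (I - {j})"
      proof -
        have "f j \<in> (I - {j}) \<rightarrow> carrier R"
          using f(1)[OF j] \<gamma> by (auto dest: ideal.Icarr)
        then have "finprod R (\<lambda>i. \<phi> (var (f j i))) (I - {j}) = finprod R (f j) (I - {j})"
          by (rule finprod_cong'[OF refl]) (simp add: fY[OF j])
        then show ?thesis using \<phi>prod[of "I - {j}"] I(1) by simp
      qed
      ultimately show "\<not> family_prods \<delta> (I - {j}) \<subseteq> \<alpha>'" using f(2)[OF j] by (auto simp: \<alpha>'_def)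
    qed (use \<delta> in auto)
    then show False by (rule absorbing_ideal_family[OF abs I])
  qed
  then show ?thesis
    using id\<alpha> unfolding strongly_n_absorbing_def I_def by (auto simp: Pi_def)
qed

text \<open>Strong absorption is applied to the principal ideals of the \<open>f i\<close>: a
  product of multiples of the \<open>f i\<close> is a multiple of their product.\<close>

lemma strongly_imp_n_absorbing:
  assumes "strongly_n_absorbing R n \<alpha>"
  shows "n_absorbing R n \<alpha>"
  unfolding n_absorbing_def
proof (intro conjI ballI impI)
  show id\<alpha>: "ideal \<alpha> R" using assms by (simp add: strongly_n_absorbing_def)
  fix f assume f: "f \<in> {1..n + 1} \<rightarrow> carrier R" "finprod R f {1..n + 1} \<in> \<alpha>"
  have fi: "f i \<in> carrier R" if "i \<in> {1..n + 1}" for i using f(1) that by blast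
  define \<gamma> where "\<gamma> i = PIdl (f i)" for i
  have \<gamma>: "ideal (\<gamma> i) R" "f i \<in> \<gamma> i" if "i \<in> {1..n + 1}" for i
    unfolding \<gamma>_def using fi[OF that] by (simp_all add: cgenideal_ideal cgenideal_self)
  have "finprod (ideals_set R) \<gamma> {1..n + 1} \<subseteq> \<alpha>"
  proof (rule ideal_finprod_subset[OF _ \<gamma>(1) id\<alpha>])
    fix h assume "\<And>i. i \<in> {1..n + 1} \<Longrightarrow> h i \<in> \<gamma> i"
    then have "\<forall>i\<in>{1..n + 1}. \<exists>r. r \<in> carrier R \<and> h i = r \<otimes> f i"
      unfolding \<gamma>_def cgenideal_def by blast
    then obtain r where r: "\<And>i. i \<in> {1..n + 1} \<Longrightarrow> r i \<in> carrier R"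
      "\<And>i. i \<in> {1..n + 1} \<Longrightarrow> h i = r i \<otimes> f i" by metis
    have "finprod R h {1..n + 1} = finprod R (\<lambda>i. r i \<otimes> f i) {1..n + 1}"
      using r fi by (intro finprod_cong') auto
    also have "\<dots> = finprod R r {1..n + 1} \<otimes> finprod R f {1..n + 1}"
      using r(1) fi by (intro finprod_multf) auto
    also have "\<dots> \<in> \<alpha>" using f(2) r(1) by (intro ideal.I_l_closed[OF id\<alpha>] finprod_closed) auto
    finally show "finprod R h {1..n + 1} \<in> \<alpha>" .
  qed simp_all
  then obtain j where j: "j \<in> {1..n + 1}" "finprod (ideals_set R) \<gamma> ({1..n + 1} - {j}) \<subseteq> \<alpha>"
    using assms \<gamma>(1) unfolding strongly_n_absorbing_def by blast
  moreover have "finprod R f ({1..n + 1} - {j}) \<in> finprod (ideals_set R) \<gamma> ({1..n + 1} - {j})"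
    using \<gamma> by (intro finprod_mem_ideal_finprod) auto
  ultimately show "\<exists>j\<in>{1..n + 1}. finprod R f ({1..n + 1} - {j}) \<in> \<alpha>" by blast
qed

end

theorem theorem3p5:
  fixes A :: "('a, 'b) ring_scheme" and \<alpha> :: "'a set"
  assumes "cring A" and "ideal \<alpha> A"
  shows "omega A \<alpha> = omega_star A \<alpha> \<and>
    (\<forall>n. n_absorbing A n \<alpha> \<longrightarrow> strongly_n_absorbing A n \<alpha>)"
proof -
  have "n_absorbing A n \<alpha> \<longleftrightarrow> strongly_n_absorbing A n \<alpha>" for n
    using cring.n_absorbing_imp_strongly[OF assms(1)] cring.strongly_imp_n_absorbing[OF assms(1)]
    by blast
  then show ?thesis by (simp add: omega_def omega_star_def)
qed

end
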